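(* Let $w$ be a non-trivial weight on $[0,1]$ and let $X$ be a symmetric space on $[0,1]$. Then $X$ is $w$-decomposable if and only if there exist $C>0$ and $1\le p\le\infty$ such that for every $n\in\mathbb N$ and all $x_1,\dots,x_n\in X$ satisfying $$\inf w(\operatorname{supp} x_i)\ \ge\ 2\,\sup w(\operatorname{supp} x_{i+1}),\qquad 1\le i\le n-1,$$ one has $$C^{-1}\Big\|\sum_{i=1}^n x_i\Big\|_X\le\Big(\sum_{i=1}^n\|x_i\|_X^p\Big)^{1/p}\le C\Big\|\sum_{i=1}^n x_i\Big\|_X,$$ where for $p=\infty$ the middle expression is replaced by $\max_{1\le i\le n}\|x_i\|_X$.
   Context: Functions are identified if they agree a.e.; $m$ is Lebesgue measure; sets such as $\operatorname{supp}x$, and infima/suprema of $w$ over such sets, are understood up to null sets. A symmetric space on $[0,1]$ is a Banach space $X$ of (classes of) measurable real functions on $[0,1]$, containing some function that is positive a.e., such that (i) $|x|\le|y|$ a.e. with $y\in X$, $x$ measurable, implies $x\in X$ and $\|x\|_X\le\|y\|_X$; (ii) if $x\in X$ and $y$ is measurable with $m\{|y|>\lambda\}=m\{|x|>\lambda\}$ for all $\lambda\ge0$, then $y\in X$ and $\|y\|_X=\|x\|_X$. A weight on $[0,1]$ is a measurable function that is positive and finite a.e.; it is non-trivial if $w$ or $1/w$ is unbounded. $X$ is $w$-decomposable if there is $C>0$ such that for every $n\in\mathbb N$ and all $x_1,\dots,x_n,y_1,\dots,y_n\in X$ with $\|x_i\|_X=\|y_i\|_X$ ($1\le i\le n$)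 and $\inf w(\operatorname{supp}x_i\cup\operatorname{supp}y_i)\ge 2\sup w(\operatorname{supp}x_{i+1}\cup\operatorname{supp}y_{i+1})$ ($1\le i\le n-1$), one has $C^{-1}\|\sum_{i=1}^n x_i\|_X\le\|\sum_{i=1}^n y_i\|_X\le C\|\sum_{i=1}^n x_i\|_X$. *)

theory Defs
  imports "HOL-Probability.Essential_Supremum"
begin

abbreviation unit_lebesgue :: "real measure" where
  "unit_lebesgue \<equiv> lebesgue_on {0..1}"

text \<open>
  A space of classes of measurable functions modulo equality almost everywhere is given by the set
  \<open>X\<close> of all representatives, with \<open>nrm\<close> a seminorm on \<open>X\<close> whose kernel consists of the
  functions vanishing almost everywhere.  By \<open>ideal\<close>, \<open>X\<close> and \<open>nrm\<close> respect equality almost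
  everywhere; values outside the unit interval are irrelevant.
\<close>

locale symmetric_space =
  fixes X :: "(real \<Rightarrow> real) set" and nrm :: "(real \<Rightarrow> real) \<Rightarrow> real"
  assumes measurable: "X \<subseteq> borel_measurable unit_lebesgue"
    and zero: "(\<lambda>t. 0) \<in> X"
    and add: "\<lbrakk>x \<in> X; y \<in> X\<rbrakk> \<Longrightarrow> (\<lambda>t. x t + y t) \<in> X"
    and scale: "x \<in> X \<Longrightarrow> (\<lambda>t. c * x t) \<in> X"
    and nrm_eq_0_iff: "x \<in> X \<Longrightarrow> nrm x = 0 \<longleftrightarrow> (AE t in unit_lebesgue. x t = 0)"
    and nrm_triangle: "\<lbrakk>x \<in> X; y \<in> X\<rbrakk> \<Longrightarrow> nrm (\<lambda>t. x t + y t) \<le> nrm x + nrm y"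
    and nrm_scale: "x \<in> X \<Longrightarrow> nrm (\<lambda>t. c * x t) = \<bar>c\<bar> * nrm x"
    and complete: "\<lbrakk>\<And>k. f k \<in> X;
        \<And>e. e > 0 \<Longrightarrow> \<exists>N. \<forall>j\<ge>N. \<forall>k\<ge>N. nrm (\<lambda>t. f j t - f k t) < e\<rbrakk>
      \<Longrightarrow> \<exists>g\<in>X. (\<lambda>k. nrm (\<lambda>t. f k t - g t)) \<longlonglongrightarrow> 0"
    and full_support: "\<exists>x\<in>X. AE t in unit_lebesgue. x t > 0"
    and ideal: "\<lbrakk>y \<in> X; x \<in> borel_measurable unit_lebesgue;
        AE t in unit_lebesgue. \<bar>x t\<bar> \<le> \<bar>y t\<bar>\<rbrakk> \<Longrightarrow> x \<in> X \<and> nrm x \<le> nrm y"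
    and symmetric: "\<lbrakk>x \<in> X; y \<in> borel_measurable unit_lebesgue;
        \<And>s. s \<ge> 0 \<Longrightarrow> measure unit_lebesgue {t\<in>{0..1}. \<bar>y t\<bar> > s}
                     = measure unit_lebesgue {t\<in>{0..1}. \<bar>x t\<bar> > s}\<rbrakk>
      \<Longrightarrow> y \<in> X \<and> nrm y = nrm x"

definition weight :: "(real \<Rightarrow> real) \<Rightarrow> bool" where
  "weight w \<longleftrightarrow> w \<in> borel_measurable unit_lebesgue \<and> (AE t in unit_lebesgue. w t > 0)"

definition nontrivial_weight :: "(real \<Rightarrow> real) \<Rightarrow> bool" where
  "nontrivial_weight w \<longleftrightarrow> weight w \<and>
     (\<not> (\<exists>B. AE t in unit_lebesgue. w t \<le> B) \<or> \<not> (\<exists>B. AE t in unit_lebesgue. 1 / w t \<le> B))"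

definition fsupp :: "(real \<Rightarrow> real) \<Rightarrow> real set" where
  "fsupp x = {t\<in>{0..1}. x t \<noteq> 0}"

text \<open>Over a null set the essential supremum is \<open>-\<infinity>\<close> and the essential infimum is \<open>\<infinity>\<close>.\<close>

definition ess_sup_on :: "(real \<Rightarrow> real) \<Rightarrow> real set \<Rightarrow> ereal" where
  "ess_sup_on w A = esssup (lebesgue_on A) (\<lambda>t. ereal (w t))"

definition ess_inf_on :: "(real \<Rightarrow> real) \<Rightarrow> real set \<Rightarrow> ereal" where
  "ess_inf_on w A = - esssup (lebesgue_on A) (\<lambda>t. - ereal (w t))"

text \<open>
  For sets of positive measure it is equivalent to compare only neighbours \<open>i\<close>, \<open>i + 1\<close>: see
  \<open>w_separated_iff_neighbours\<close> below.  Null sets (that is, vanishing functions) are allowed, and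
  the condition is imposed on all pairs \<open>i < j\<close> because otherwise a single null set in the family
  would cancel any relation between its predecessors and its successors, so that even \<open>x, 0, -x\<close>
  would count as separated.
\<close>

definition w_separated :: "(real \<Rightarrow> real) \<Rightarrow> nat \<Rightarrow> (nat \<Rightarrow> real set) \<Rightarrow> bool" where
  "w_separated w n A \<longleftrightarrow>
     (\<forall>i j. 1 \<le> i \<and> i < j \<and> j \<le> n \<longrightarrow> ess_inf_on w (A i) \<ge> 2 * ess_sup_on w (A j))"

definition w_decomposable ::
  "(real \<Rightarrow> real) \<Rightarrow> (real \<Rightarrow> real) set \<Rightarrow> ((real \<Rightarrow> real) \<Rightarrow> real) \<Rightarrow> bool" where
  "w_decomposable w X nrm \<longleftrightarrow>
     (\<exists>C>0. \<forall>n\<ge>1. \<forall>x y.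
        (\<forall>i\<in>{1..n}. x i \<in> X \<and> y i \<in> X \<and> nrm (x i) = nrm (y i)) \<and>
        w_separated w n (\<lambda>i. fsupp (x i) \<union> fsupp (y i)) \<longrightarrow>
        inverse C * nrm (\<lambda>t. \<Sum>i=1..n. x i t) \<le> nrm (\<lambda>t. \<Sum>i=1..n. y i t) \<and>
        nrm (\<lambda>t. \<Sum>i=1..n. y i t) \<le> C * nrm (\<lambda>t. \<Sum>i=1..n. x i t))"

definition lp_norm :: "ereal \<Rightarrow> nat \<Rightarrow> (nat \<Rightarrow> real) \<Rightarrow> real" where
  "lp_norm p n a =
     (if p = \<infinity> then Max ((\<lambda>i. \<bar>a i\<bar>) ` {1..n})
      else (\<Sum>i=1..n. \<bar>a i\<bar> powr real_of_ereal p) powr (1 / real_of_ereal p))"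

lemma weight_ess_bounds:
  assumes w: "weight w" and A: "A \<in> sets lebesgue" "A \<subseteq> {0..1}" "emeasure lebesgue A \<noteq> 0"
  shows "ess_inf_on w A \<le> ess_sup_on w A" "0 < ess_sup_on w A"
proof -
  let ?M = "lebesgue_on A"
  have ae_trans: "AE t in ?M. P t" if "AE t in unit_lebesgue. P t" for P
  proof -
    have "AE t in lebesgue. t \<in> {0..1} \<longrightarrow> P t"
      using that by (subst (asm) AE_restrict_space_iff) auto
    then have "AE t in lebesgue. t \<in> A \<longrightarrow> P t"
      using A(2) by (auto elim!: eventually_mono)
    then show ?thesis
      using A(1) by (subst AE_restrict_space_iff) auto
  qed
  have pos: "AE t in ?M. w t > 0"
    using w unfolding weight_def by (intro ae_trans) auto
  have "emeasure ?M (space ?M) \<noteq> 0"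
    using A(1,3) by (simp add: emeasure_restrict_space)
  then have nz: "ae_filter ?M \<noteq> bot"
    by (simp add: ae_filter_eq_bot_iff)
  have up: "AE t in ?M. ereal (w t) \<le> ess_sup_on w A"
    unfolding ess_sup_on_def by (rule esssup_AE)
  have "AE t in ?M. - ereal (w t) \<le> - ess_inf_on w A"
    unfolding ess_inf_on_def using esssup_AE[of "\<lambda>t. - ereal (w t)" ?M] by simp
  then have low: "AE t in ?M. ess_inf_on w A \<le> ereal (w t)"
    by (simp only: ereal_minus_le_minus)
  have "AE t in ?M. ess_inf_on w A \<le> ess_sup_on w A \<and> 0 < ess_sup_on w A"
    using pos up low
    by eventually_elim (meson ereal_less(2) less_le_trans order.trans)
  then have "ess_inf_on w A \<le> ess_sup_on w A \<and> 0 < ess_sup_on w A"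
    using nz by (simp add: eventually_const)
  then show "ess_inf_on w A \<le> ess_sup_on w A" "0 < ess_sup_on w A" by auto
qed

lemma w_separated_iff_neighbours:
  assumes w: "weight w"
    and A: "\<And>i. i \<in> {1..n} \<Longrightarrow> A i \<in> sets lebesgue \<and> A i \<subseteq> {0..1} \<and> emeasure lebesgue (A i) \<noteq> 0"
  shows "w_separated w n A \<longleftrightarrow>
    (\<forall>i. 1 \<le> i \<and> i \<le> n - 1 \<longrightarrow> ess_inf_on w (A i) \<ge> 2 * ess_sup_on w (A (i + 1)))"
proof
  assume "w_separated w n A"
  then show "\<forall>i. 1 \<le> i \<and> i \<le> n - 1 \<longrightarrow> ess_inf_on w (A i) \<ge> 2 * ess_sup_on w (A (i + 1))"
    unfolding w_separated_def by auto
next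
  assume nb: "\<forall>i. 1 \<le> i \<and> i \<le> n - 1 \<longrightarrow> ess_inf_on w (A i) \<ge> 2 * ess_sup_on w (A (i + 1))"
  have dbl: "s \<le> 2 * s" if "0 < s" for s :: ereal
    using that by (cases s) auto
  have "1 \<le> i \<Longrightarrow> i + Suc d \<le> n \<Longrightarrow> ess_inf_on w (A i) \<ge> 2 * ess_sup_on w (A (i + Suc d))" for i d
  proof (induction d)
    case 0
    then show ?case using nb by auto
  next
    case (Suc d)
    let ?k = "i + Suc d"
    have k: "?k \<in> {1..n}" "1 \<le> ?k" "?k \<le> n - 1" using Suc.prems by auto
    have "2 * ess_sup_on w (A (?k + 1)) \<le> ess_inf_on w (A ?k)"
      using nb k by blast
    also have "\<dots> \<le> ess_sup_on w (A ?k)"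
      using weight_ess_bounds[OF w] A[OF k(1)] by blast
    also have "\<dots> \<le> 2 * ess_sup_on w (A ?k)"
      using weight_ess_bounds[OF w] A[OF k(1)] by (intro dbl) blast
    also have "\<dots> \<le> ess_inf_on w (A i)"
      using Suc by simp
    finally show ?case by simp
  qed
  then show "w_separated w n A"
    unfolding w_separated_def by (metis less_iff_Suc_add add_Suc_right)
qed

end

theory Submission
  imports Defs
begin

text \<open>
  Suppose \<open>X\<close> is \<open>w\<close>-decomposable.  Inside the supports of two separated families with equal norms
  choose pairwise disjoint sets of one common measure.  Decomposability replaces each family by the
  step functions on these sets, and the two step functions are equimeasurable.  So the norm of the
  sum of a separated family depends, up to a constant, only on the norms of the members.  As the
  weight is non-trivial there are arbitrarily long separated families, and the block sums of a
  separated family are again separated.  This is the situation of Zippin's theorem on perfectly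
  homogeneous bases: the norm \<open>\<lambda> n\<close> of a sum of \<open>n\<close> separated unit vectors is multiplicative and
  monotone up to constants, hence comparable to \<open>n powr c\<close> with \<open>0 \<le> c \<le> 1\<close>, and \<open>p = 1 / c\<close>;
  coefficients are handled by replacing a vector of norm \<open>a\<close> by a block of about \<open>M * a powr p\<close>
  unit vectors.
\<close>

section \<open>Almost multiplicative sequences\<close>

text \<open>
  Comparing \<open>n ^ k\<close> with the neighbouring powers of \<open>m\<close> and letting \<open>k\<close> grow gives
  \<open>(f n - A) / ln n \<le> (f m + A) / ln m\<close> for all \<open>m, n\<close>; the supremum of the left-hand sides is the exponent.
\<close>

lemma almost_additive_log:
  fixes f :: "nat \<Rightarrow> real"
  assumes A: "A \<ge> 0"
    and lo: "\<And>n. 1 \<le> n \<Longrightarrow> - A \<le> f n"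
    and up: "\<And>n. 1 \<le> n \<Longrightarrow> f n \<le> ln (real n) + A"
    and mono: "\<And>m n. 1 \<le> m \<Longrightarrow> m \<le> n \<Longrightarrow> f m \<le> f n + A"
    and mult: "\<And>m n. 1 \<le> m \<Longrightarrow> 1 \<le> n \<Longrightarrow> \<bar>f (m * n) - f m - f n\<bar> \<le> A"
  shows "\<exists>c. 0 \<le> c \<and> c \<le> 1 \<and> (\<forall>n\<ge>1. \<bar>f n - c * ln (real n)\<bar> \<le> 2 * A)"
proof -
  have pow: "\<bar>f (n ^ k) - real k * f n\<bar> \<le> real k * A" if "1 \<le> n" "1 \<le> k" for n k
    using that(2)
  proof (induction k rule: dec_induct)
    case base
    then show ?case using A by simp
  next
    case (step k)
    have "\<bar>f (n * n ^ k) - f n - f (n ^ k)\<bar> \<le> A" using mult that by simp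
    with step show ?case by (simp add: algebra_simps abs_le_iff)
  qed
  have key: "(f n - A) * ln (real m) \<le> (f m + A) * ln (real n)" if mn: "2 \<le> m" "2 \<le> n" for m n
  proof -
    have lnm: "ln (real m) > 0" and lnn: "ln (real n) > 0" using mn by auto
    have fm: "f m + A \<ge> 0" using lo[of m] mn by simp
    have step: "real k * ((f n - A) * ln (real m) - (f m + A) * ln (real n))
        \<le> ln (real m) * (f m + 2 * A)" if k: "1 \<le> k" for k
    proof -
      \<comment> \<open>\<open>l\<close> is the integer part of the logarithm of
        \<open>n ^ k\<close> to base \<open>m\<close>. Monotonicity then bounds
        \<open>f (n ^ k)\<close> by \<open>f (m ^ Suc l)\<close> up to \<open>A\<close>, and
        \<open>pow\<close> linearises both values.\<close>
      obtain l where l: "m ^ l \<le> n ^ k" "n ^ k < m ^ Suc l"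
        using ex_power_ivl1[of m "n ^ k"] mn by auto
      have "real k * f n - real k * A \<le> f (n ^ k)"
        using pow[of n k] k mn by (simp add: abs_le_iff)
      also have "\<dots> \<le> f (m ^ Suc l) + A"
        using mono[of "n ^ k" "m ^ Suc l"] l mn by simp
      also have "\<dots> \<le> real (Suc l) * f m + real (Suc l) * A + A"
        using pow[of m "Suc l"] mn by (simp add: abs_le_iff)
      finally have 1: "real k * (f n - A) \<le> real (Suc l) * (f m + A) + A"
        by (simp add: algebra_simps)
      have "real m ^ l \<le> real n ^ k"
        using l(1) by (metis of_nat_le_iff of_nat_power)
      then have "ln (real m ^ l) \<le> ln (real n ^ k)"
        using mn by (subst ln_le_cancel_iff) auto
      then have 2: "real l * ln (real m) \<le> real k * ln (real n)"
        using mn by (simp add: ln_realpow)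
      have "real k * (f n - A) * ln (real m) \<le> (real (Suc l) * (f m + A) + A) * ln (real m)"
        using 1 lnm by (simp add: mult_right_mono)
      also have "\<dots> = (real l * ln (real m)) * (f m + A) + ln (real m) * (f m + 2 * A)"
        by (simp add: algebra_simps)
      also have "\<dots> \<le> (real k * ln (real n)) * (f m + A) + ln (real m) * (f m + 2 * A)"
        using 2 fm by (simp add: mult_right_mono)
      finally show ?thesis by (simp add: algebra_simps)
    qed
    \<comment> \<open>The right side of \<open>step\<close> does not depend on \<open>k\<close>, so
      a positive factor of \<open>k\<close> on its left would violate it for large
      \<open>k\<close>.\<close>
    have "(f n - A) * ln (real m) - (f m + A) * ln (real n) \<le> 0"
    proof (rule ccontr)
      assume "\<not> ?thesis"
      then have p: "0 < (f n - A) * ln (real m) - (f m + A) * ln (real n)" by simp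
      then obtain k where k: "ln (real m) * (f m + 2 * A) <
          real k * ((f n - A) * ln (real m) - (f m + A) * ln (real n))"
        using reals_Archimedean3 by blast
      moreover have "0 \<le> ln (real m) * (f m + 2 * A)"
        using lnm fm A by simp
      ultimately have "k \<noteq> 0" by (metis mult_zero_left not_less of_nat_0)
      with step[of k] k show False by simp
    qed
    then show ?thesis by simp
  qed
  define S where "S = (\<lambda>n. (f n - A) / ln (real n)) ` {2..}"
  define c where "c = Sup S"
  \<comment> \<open>Every \<open>m\<close> yields an upper bound of the whole set \<open>S\<close>.
    One of them makes the supremum exist, and being least it lies below all of them.\<close>
  have le: "s \<le> (f m + A) / ln (real m)" if "s \<in> S" "2 \<le> m" for s m
    using that key[of m] unfolding S_def by (auto simp: field_simps)
  have bdd: "bdd_above S" by (rule bdd_aboveI[of _ "(f 2 + A) / ln (real 2)"]) (rule le, auto)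
  have ne: "S \<noteq> {}" unfolding S_def by auto
  have c1: "(f n - A) / ln (real n) \<le> c" if "2 \<le> n" for n
    unfolding c_def using that bdd by (intro cSup_upper) (auto simp: S_def)
  have c2: "c \<le> (f n + A) / ln (real n)" if "2 \<le> n" for n
    unfolding c_def using le that ne by (intro cSup_least) auto
  have large: "\<exists>n\<ge>2. ln (real n) > B" for B
  proof -
    obtain n where "exp B < real n" using reals_Archimedean2 by blast
    then have "B < ln (real (max 2 n))"
      by (metis dual_order.strict_trans exp_gt_zero less_max_iff_disj ln_exp ln_less_cancel_iff of_nat_less_iff of_nat_max)
    then show ?thesis by (intro exI[of _ "max 2 n"]) auto
  qed
  \<comment> \<open>The logarithm is unbounded, so a negative \<open>c\<close> would push some
    \<open>f n\<close> below \<open>- A\<close>. Below, \<open>c > 1\<close> contradicts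
    \<open>up\<close> in the same way.\<close>
  have "c \<ge> 0"
  proof (rule ccontr)
    assume "\<not> c \<ge> 0"
    then obtain n where n: "n \<ge> 2" "ln (real n) > 2 * A / (-c)" using large by blast
    then have "(f n - A) \<le> c * ln (real n)" using c1[of n] by (simp add: field_simps)
    moreover have "2 * A < - c * ln (real n)" using n \<open>\<not> c \<ge> 0\<close> by (simp add: field_simps)
    ultimately show False using lo[of n] n by simp
  qed
  moreover have "c \<le> 1"
  proof (rule ccontr)
    assume "\<not> c \<le> 1"
    then obtain n where n: "n \<ge> 2" "ln (real n) > 2 * A / (c - 1)" using large by blast
    then have "c * ln (real n) \<le> f n + A" using c2[of n] by (simp add: field_simps)
    moreover have "2 * A < (c - 1) * ln (real n)" using n \<open>\<not> c \<le> 1\<close> by (simp add: field_simps)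
    ultimately show False using up[of n] n by (simp add: algebra_simps)
  qed
  moreover have "\<bar>f n - c * ln (real n)\<bar> \<le> 2 * A" if "n \<ge> 1" for n
  proof (cases "n = 1")
    \<comment> \<open>At \<open>n = 1\<close> the logarithm vanishes, and \<open>lo\<close> and
      \<open>up\<close> give the bound directly.\<close>
    case True
    then show ?thesis using lo[of 1] up[of 1] A by simp
  next
    case False
    then have "n \<ge> 2" using that by simp
    then show ?thesis using c1[of n] c2[of n] A by (simp add: field_simps abs_le_iff)
  qed
  ultimately show ?thesis by blast
qed

text \<open>Logarithms turn this into \<open>almost_additive_log\<close> with
  \<open>A = ln L\<close>; \<open>lo\<close> makes \<open>lam n\<close> positive. Exponentiating the
  error \<open>2 * ln L\<close> gives \<open>D = L\<^sup>2\<close>.\<close>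

lemma almost_multiplicative_power:
  fixes lam :: "nat \<Rightarrow> real"
  assumes L: "L \<ge> 1"
    and lo: "\<And>n. 1 \<le> n \<Longrightarrow> 1 \<le> L * lam n"
    and up: "\<And>n. 1 \<le> n \<Longrightarrow> lam n \<le> L * real n"
    and mono: "\<And>m n. 1 \<le> m \<Longrightarrow> m \<le> n \<Longrightarrow> lam m \<le> L * lam n"
    and mult_le: "\<And>m n. 1 \<le> m \<Longrightarrow> 1 \<le> n \<Longrightarrow> lam (m * n) \<le> L * (lam m * lam n)"
    and mult_ge: "\<And>m n. 1 \<le> m \<Longrightarrow> 1 \<le> n \<Longrightarrow> lam m * lam n \<le> L * lam (m * n)"
  shows "\<exists>c D. 0 \<le> c \<and> c \<le> 1 \<and> 1 \<le> D \<and>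
    (\<forall>n\<ge>1. real n powr c \<le> D * lam n \<and> lam n \<le> D * real n powr c)"
proof -
  have pos: "lam n > 0" if "1 \<le> n" for n
    using lo[OF that] L by (metis less_le_trans zero_less_mult_pos zero_less_one)
  have ln_le: "ln a \<le> ln L + ln b" if "a \<le> L * b" "0 < a" "0 < b" for a b
    using that L by (metis less_le_trans ln_le_cancel_iff ln_mult_pos mult_pos_pos zero_less_one)
  have "\<exists>c. 0 \<le> c \<and> c \<le> 1 \<and> (\<forall>n\<ge>1. \<bar>ln (lam n) - c * ln (real n)\<bar> \<le> 2 * ln L)"
  proof (rule almost_additive_log)
    show "0 \<le> ln L" using L by simp
    show "- ln L \<le> ln (lam n)" if "1 \<le> n" for n
      using ln_le[OF lo[OF that]] pos[OF that] by simp
    show "ln (lam n) \<le> ln (real n) + ln L" if "1 \<le> n" for n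
      using ln_le[OF up[OF that]] pos[OF that] that by simp
    show "ln (lam m) \<le> ln (lam n) + ln L" if "1 \<le> m" "m \<le> n" for m n
      using ln_le[OF mono[OF that]] pos[of m] pos[of n] that by simp
    show "\<bar>ln (lam (m * n)) - ln (lam m) - ln (lam n)\<bar> \<le> ln L" if "1 \<le> m" "1 \<le> n" for m n
    proof -
      have p: "lam m > 0" "lam n > 0" "lam (m * n) > 0" using pos that by auto
      then show ?thesis
        using ln_le[OF mult_le[OF that]] ln_le[OF mult_ge[OF that]] by (simp add: ln_mult_pos)
    qed
  qed
  then obtain c where c: "0 \<le> c" "c \<le> 1"
    and *: "\<And>n. 1 \<le> n \<Longrightarrow> \<bar>ln (lam n) - c * ln (real n)\<bar> \<le> 2 * ln L" by blast
  have L2: "L\<^sup>2 = exp (2 * ln L)" using L by (simp add: exp_double)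
  have "real n powr c \<le> L\<^sup>2 * lam n \<and> lam n \<le> L\<^sup>2 * real n powr c" if n: "1 \<le> n" for n
  proof -
    have p: "real n powr c = exp (c * ln (real n))" using n by (simp add: powr_def)
    have q: "lam n = exp (ln (lam n))" using pos[OF n] by simp
    have "c * ln (real n) \<le> 2 * ln L + ln (lam n)" "ln (lam n) \<le> 2 * ln L + c * ln (real n)"
      using *[OF n] by auto
    then show ?thesis
      unfolding p L2 by (subst (1 2) q) (simp flip: exp_add)
  qed
  moreover have "1 \<le> L\<^sup>2" using L by simp
  ultimately show ?thesis using c by blast
qed

section \<open>Separated sets\<close>

text \<open>The threshold \<open>c\<close> is extended real so that a null set is separated from every set on either side.\<close>

definition sep :: "(real \<Rightarrow> real) \<Rightarrow> real set \<Rightarrow> real set \<Rightarrow> bool" where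
  "sep w A B \<longleftrightarrow> (\<exists>c::ereal. (AE t in unit_lebesgue. t \<in> A \<longrightarrow> 2 * c \<le> ereal (w t)) \<and>
     (AE t in unit_lebesgue. t \<in> B \<longrightarrow> ereal (w t) \<le> c))"

section \<open>Essential bounds and separation as almost everywhere statements\<close>

lemma sets_unit_lebesgue_iff: "A \<in> sets unit_lebesgue \<longleftrightarrow> A \<in> sets lebesgue \<and> A \<subseteq> {0..1}"
  by (auto simp: sets_restrict_space_iff)

lemma AE_lebesgue_on_subset_iff:
  assumes "A \<in> sets unit_lebesgue"
  shows "(AE t in lebesgue_on A. P t) \<longleftrightarrow> (AE t in unit_lebesgue. t \<in> A \<longrightarrow> P t)"
proof -
  have A: "A \<in> sets lebesgue" "A \<subseteq> {0..1}" using assms by (auto simp: sets_unit_lebesgue_iff)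
  have "(AE t in lebesgue_on A. P t) \<longleftrightarrow> (AE t in lebesgue. t \<in> A \<longrightarrow> P t)"
    using A by (subst AE_restrict_space_iff) auto
  also have "\<dots> \<longleftrightarrow> (AE t in lebesgue. t \<in> {0..1} \<longrightarrow> t \<in> A \<longrightarrow> P t)"
    using A(2) by (intro iffI; elim eventually_mono) auto
  also have "\<dots> \<longleftrightarrow> (AE t in unit_lebesgue. t \<in> A \<longrightarrow> P t)"
    by (subst AE_restrict_space_iff) auto
  finally show ?thesis .
qed

lemma ess_sup_on_le_iff:
  assumes "w \<in> borel_measurable unit_lebesgue" "A \<in> sets unit_lebesgue"
  shows "ess_sup_on w A \<le> c \<longleftrightarrow> (AE t in unit_lebesgue. t \<in> A \<longrightarrow> ereal (w t) \<le> c)"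
proof -
  have A: "A \<in> sets lebesgue" "A \<subseteq> {0..1}" using assms by (auto simp: sets_unit_lebesgue_iff)
  have m: "w \<in> borel_measurable (lebesgue_on A)"
    using assms(1) A(2) by (rule measurable_restrict_mono)
  have "esssup (lebesgue_on A) (\<lambda>t. ereal (w t)) \<le> c \<longleftrightarrow> (AE t in lebesgue_on A. ereal (w t) \<le> c)"
  proof
    assume "esssup (lebesgue_on A) (\<lambda>t. ereal (w t)) \<le> c"
    then show "AE t in lebesgue_on A. ereal (w t) \<le> c"
      by (intro eventually_mono[OF esssup_AE[of "\<lambda>t. ereal (w t)" "lebesgue_on A"]]) auto
  next
    assume "AE t in lebesgue_on A. ereal (w t) \<le> c"
    then show "esssup (lebesgue_on A) (\<lambda>t. ereal (w t)) \<le> c"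
      using m by (intro esssup_I) auto
  qed
  then show ?thesis
    unfolding ess_sup_on_def using AE_lebesgue_on_subset_iff[OF assms(2)] by simp
qed

text \<open>Negation exchanges lower and upper bounds, so this is \<open>ess_sup_on_le_iff\<close>
  for \<open>- w\<close>.\<close>

lemma le_ess_inf_on_iff:
  assumes "w \<in> borel_measurable unit_lebesgue" "A \<in> sets unit_lebesgue"
  shows "c \<le> ess_inf_on w A \<longleftrightarrow> (AE t in unit_lebesgue. t \<in> A \<longrightarrow> c \<le> ereal (w t))"
proof -
  have "c \<le> ess_inf_on w A \<longleftrightarrow> ess_sup_on (\<lambda>t. - w t) A \<le> - c"
    unfolding ess_inf_on_def ess_sup_on_def by (simp, metis ereal_minus_le_minus ereal_uminus_uminus)
  also have "\<dots> \<longleftrightarrow> (AE t in unit_lebesgue. t \<in> A \<longrightarrow> ereal (- w t) \<le> - c)"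
    using assms by (intro ess_sup_on_le_iff) auto
  also have "\<dots> \<longleftrightarrow> (AE t in unit_lebesgue. t \<in> A \<longrightarrow> c \<le> ereal (w t))"
    by (simp add: ereal_minus_le_minus flip: uminus_ereal.simps)
  finally show ?thesis .
qed

lemma ereal_double_mono: "a \<le> b \<Longrightarrow> 2 * a \<le> 2 * (b::ereal)"
  by (rule ereal_mult_left_mono) auto

text \<open>The essential supremum over \<open>B\<close> is the smallest threshold that bounds
  \<open>w\<close> on \<open>B\<close>, hence the weakest demand on \<open>A\<close>: if any
  threshold works, this one does.\<close>

lemma sep_iff_ess:
  assumes w: "w \<in> borel_measurable unit_lebesgue" and A: "A \<in> sets unit_lebesgue" and B: "B \<in> sets unit_lebesgue"
  shows "ess_inf_on w A \<ge> 2 * ess_sup_on w B \<longleftrightarrow> sep w A B"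
proof
  assume "ess_inf_on w A \<ge> 2 * ess_sup_on w B"
  then show "sep w A B" unfolding sep_def
    using le_ess_inf_on_iff[OF w A, of "2 * ess_sup_on w B"] ess_sup_on_le_iff[OF w B, of "ess_sup_on w B"]
    by (intro exI[of _ "ess_sup_on w B"]) simp
next
  assume "sep w A B"
  then obtain c where "2 * c \<le> ess_inf_on w A" "ess_sup_on w B \<le> c"
    unfolding sep_def using le_ess_inf_on_iff[OF w A] ess_sup_on_le_iff[OF w B] by auto
  then show "ess_inf_on w A \<ge> 2 * ess_sup_on w B"
    using ereal_double_mono order_trans by blast
qed

section \<open>Stability of separation under subsets and finite unions\<close>

lemma sep_mono: "sep w A B \<Longrightarrow> A' \<subseteq> A \<Longrightarrow> B' \<subseteq> B \<Longrightarrow> sep w A' B'"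
  unfolding sep_def
  by (elim exE conjE, rule exI, rule conjI) (erule eventually_mono, blast)+

lemma sep_empty_left: "sep w {} B" and sep_empty_right: "sep w A {}"
  unfolding sep_def by (rule exI[of _ \<infinity>], simp) (rule exI[of _ "-\<infinity>"], simp)

text \<open>Both thresholds bound \<open>w\<close> on the common set \<open>B\<close>, so their
  minimum does, and passing to it only weakens the demands on \<open>A\<close> and
  \<open>A'\<close>.\<close>

lemma sep_Un_left:
  assumes "sep w A B" "sep w A' B" shows "sep w (A \<union> A') B"
proof -
  obtain c c' where c:
    "AE t in unit_lebesgue. t \<in> A \<longrightarrow> 2 * c \<le> ereal (w t)" "AE t in unit_lebesgue. t \<in> B \<longrightarrow> ereal (w t) \<le> c"
    "AE t in unit_lebesgue. t \<in> A' \<longrightarrow> 2 * c' \<le> ereal (w t)" "AE t in unit_lebesgue. t \<in> B \<longrightarrow> ereal (w t) \<le> c'"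
    using assms unfolding sep_def by auto
  have "2 * min c c' \<le> 2 * c" "2 * min c c' \<le> 2 * c'" by (rule ereal_double_mono, simp)+
  then have "AE t in unit_lebesgue. t \<in> A \<union> A' \<longrightarrow> 2 * min c c' \<le> ereal (w t)"
    using c(1,3) by (auto elim: eventually_elim2 intro: order_trans)
  moreover have "AE t in unit_lebesgue. t \<in> B \<longrightarrow> ereal (w t) \<le> min c c'"
    using c(2,4) by eventually_elim simp
  ultimately show ?thesis unfolding sep_def by blast
qed

text \<open>Dual to \<open>sep_Un_left\<close>, with the maximum of the two thresholds.\<close>

lemma sep_Un_right:
  assumes "sep w A B" "sep w A B'" shows "sep w A (B \<union> B')"
proof -
  obtain c c' where c:
    "AE t in unit_lebesgue. t \<in> A \<longrightarrow> 2 * c \<le> ereal (w t)" "AE t in unit_lebesgue. t \<in> B \<longrightarrow> ereal (w t) \<le> c"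
    "AE t in unit_lebesgue. t \<in> A \<longrightarrow> 2 * c' \<le> ereal (w t)" "AE t in unit_lebesgue. t \<in> B' \<longrightarrow> ereal (w t) \<le> c'"
    using assms unfolding sep_def by auto
  have "AE t in unit_lebesgue. t \<in> A \<longrightarrow> 2 * max c c' \<le> ereal (w t)"
    using c(1,3) by eventually_elim (simp add: max_def)
  moreover have "AE t in unit_lebesgue. t \<in> B \<union> B' \<longrightarrow> ereal (w t) \<le> max c c'"
    using c(2,4) by eventually_elim (auto simp: le_max_iff_disj)
  ultimately show ?thesis unfolding sep_def by blast
qed

text \<open>The support of a block sum lies in the finite union of the supports in the block, so
  this carries separation over from single vectors to blocks.\<close>

lemma sep_UN:
  assumes "finite I" "finite J" "\<And>i j. i \<in> I \<Longrightarrow> j \<in> J \<Longrightarrow> sep w (A i) (B j)"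
  shows "sep w (\<Union>i\<in>I. A i) (\<Union>j\<in>J. B j)"
proof -
  have "sep w (A i) (\<Union>j\<in>J. B j)" if "i \<in> I" for i
    using assms(2) assms(3)[OF that]
    by (induction J rule: finite_induct) (auto intro: sep_empty_right sep_Un_right)
  with assms(1) show ?thesis
    by (induction I rule: finite_induct) (auto intro: sep_empty_left sep_Un_left)
qed

text \<open>A common point would satisfy \<open>2 * c \<le> w t \<le> c\<close>. For real
  \<open>c\<close> this contradicts \<open>w t > 0\<close>; for infinite \<open>c\<close> it fails
  because \<open>w t\<close> is real.\<close>

lemma sep_imp_AE_disjoint:
  assumes "weight w" "sep w A B"
  shows "AE t in unit_lebesgue. \<not> (t \<in> A \<and> t \<in> B)"
proof -
  obtain c where c: "AE t in unit_lebesgue. t \<in> A \<longrightarrow> 2 * c \<le> ereal (w t)"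
    "AE t in unit_lebesgue. t \<in> B \<longrightarrow> ereal (w t) \<le> c"
    using assms(2) unfolding sep_def by auto
  have "AE t in unit_lebesgue. w t > 0" using assms(1) by (simp add: weight_def)
  then show ?thesis using c
    by eventually_elim (cases c, auto)
qed

text \<open>Lebesgue measure has no atoms: the measure of \<open>F \<inter> {0..r}\<close> is
  1-Lipschitz in \<open>r\<close> and grows from 0 to the measure of \<open>F\<close>, so the
  intermediate value theorem yields a cut of measure \<open>d\<close>.\<close>

lemma exists_subset_of_measure:
  assumes F: "F \<in> sets unit_lebesgue" and d: "0 \<le> d" "d \<le> measure unit_lebesgue F"
  shows "\<exists>E \<in> sets unit_lebesgue. E \<subseteq> F \<and> measure unit_lebesgue E = d"
proof -
  have F': "F \<in> sets lebesgue" "F \<subseteq> {0..1}" using F by (auto simp: sets_unit_lebesgue_iff)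
  have lm: "F \<inter> {a..b} \<in> lmeasurable" for a b
    using fmeasurable_Int_fmeasurable[of "{a..b}" lebesgue F] F' by (simp add: Int_commute)
  define g where "g r = measure lebesgue (F \<inter> {0..r})" for r :: real
  have lip: "\<bar>g r - g s\<bar> \<le> \<bar>r - s\<bar>" for r s
  proof -
    have *: "g r \<le> g s + (r - s) \<and> g s \<le> g r" if "s \<le> r" for r s
    proof
      have "g r \<le> measure lebesgue ((F \<inter> {0..s}) \<union> {s..r})"
        unfolding g_def using lm by (intro measure_mono_fmeasurable) auto
      also have "\<dots> \<le> g s + measure lebesgue {s..r}"
        unfolding g_def using lm by (intro measure_Un_le) auto
      finally show "g r \<le> g s + (r - s)" using that by simp
      show "g s \<le> g r"
        unfolding g_def using lm that by (intro measure_mono_fmeasurable) auto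
    qed
    show ?thesis using *[of r s] *[of s r] by (cases "r \<le> s") auto
  qed
  have "continuous_on {0..1} g"
    unfolding continuous_on_iff dist_real_def using lip le_less_trans by blast
  moreover have "g 0 \<le> d"
  proof -
    have "g 0 \<le> measure lebesgue (cbox 0 (0::real))"
      unfolding g_def using lm[of 0 0] by (intro measure_mono_fmeasurable lmeasurable_cbox) auto
    then show ?thesis using d by simp
  qed
  moreover have "d \<le> g 1"
  proof -
    have "F \<inter> {0..1} = F" using F' by auto
    then show ?thesis using d F' unfolding g_def by (simp add: measure_restrict_space)
  qed
  ultimately obtain r where r: "0 \<le> r" "r \<le> 1" "g r = d"
    using IVT'[of g 0 d 1] by auto
  have "measure unit_lebesgue (F \<inter> {0..r}) = g r"
    unfolding g_def using F' by (subst measure_restrict_space) auto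
  moreover have "F \<inter> {0..r} \<in> sets unit_lebesgue"
    using F' by (auto simp: sets_unit_lebesgue_iff)
  ultimately show ?thesis using r by blast
qed

interpretation unit_lebesgue: finite_measure unit_lebesgue
  by (rule finite_measureI) (simp add: emeasure_restrict_space)

lemma not_AE_imp_measure_pos:
  assumes "{t \<in> {0..1}. P t} \<in> sets unit_lebesgue" "\<not> (AE t in unit_lebesgue. \<not> P t)"
  shows "0 < measure unit_lebesgue {t \<in> {0..1}. P t}"
proof -
  have "emeasure unit_lebesgue {t \<in> {0..1}. P t} \<noteq> 0"
    using assms by (subst (asm) AE_iff_measurable[OF assms(1)]) auto
  then show ?thesis
    by (simp add: unit_lebesgue.emeasure_eq_measure less_le)
qed

section \<open>Separated families in symmetric spaces\<close>

context symmetric_space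
begin

definition admissible :: "(real \<Rightarrow> real) \<Rightarrow> nat \<Rightarrow> (nat \<Rightarrow> real \<Rightarrow> real) \<Rightarrow> bool" where
  "admissible w n x \<longleftrightarrow> (\<forall>i\<in>{1..n}. x i \<in> X) \<and>
     (\<forall>i j. 1 \<le> i \<and> i < j \<and> j \<le> n \<longrightarrow> sep w (fsupp (x i)) (fsupp (x j)))"

lemma borel: "x \<in> X \<Longrightarrow> x \<in> borel_measurable unit_lebesgue"
  using measurable by auto

lemma fsupp_sets: "x \<in> X \<Longrightarrow> fsupp x \<in> sets unit_lebesgue"
proof -
  assume "x \<in> X"
  then have [measurable]: "x \<in> borel_measurable unit_lebesgue" by (rule borel)
  have "{t \<in> space unit_lebesgue. x t \<noteq> 0} \<in> sets unit_lebesgue" by measurable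
  then show ?thesis by (simp add: fsupp_def)
qed

lemma admissible_iff_w_separated:
  assumes "weight w"
  shows "admissible w n x \<longleftrightarrow> (\<forall>i\<in>{1..n}. x i \<in> X) \<and> w_separated w n (\<lambda>i. fsupp (x i))"
proof -
  have "ess_inf_on w (fsupp (x i)) \<ge> 2 * ess_sup_on w (fsupp (x j)) \<longleftrightarrow> sep w (fsupp (x i)) (fsupp (x j))"
    if "\<forall>i\<in>{1..n}. x i \<in> X" "1 \<le> i" "i < j" "j \<le> n" for i j
    using assms that by (intro sep_iff_ess fsupp_sets) (auto simp: weight_def)
  then show ?thesis
    unfolding admissible_def w_separated_def by blast
qed

section \<open>Norms of sums and of disjointly supported functions\<close>

lemma nrm_zero: "nrm (\<lambda>t. 0) = 0"
  using nrm_eq_0_iff[OF zero] by simp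

lemma nrm_nonneg: "x \<in> X \<Longrightarrow> 0 \<le> nrm x"
  using ideal[of x "\<lambda>t. 0"] nrm_zero by simp

lemma sum_mem: "finite I \<Longrightarrow> (\<And>i. i \<in> I \<Longrightarrow> x i \<in> X) \<Longrightarrow> (\<lambda>t. \<Sum>i\<in>I. x i t) \<in> X"
proof (induction I rule: finite_induct)
  case empty
  then show ?case using zero by simp
next
  case (insert i I)
  then show ?case using add[of "x i" "\<lambda>t. \<Sum>i\<in>I. x i t"] by simp
qed

lemma nrm_sum_le: "finite I \<Longrightarrow> (\<And>i. i \<in> I \<Longrightarrow> x i \<in> X) \<Longrightarrow> nrm (\<lambda>t. \<Sum>i\<in>I. x i t) \<le> (\<Sum>i\<in>I. nrm (x i))"
proof (induction I rule: finite_induct)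
  case empty
  then show ?case by (simp add: nrm_zero)
next
  case (insert i I)
  then have "nrm (\<lambda>t. x i t + (\<Sum>i\<in>I. x i t)) \<le> nrm (x i) + nrm (\<lambda>t. \<Sum>i\<in>I. x i t)"
    using sum_mem[of I x] by (intro nrm_triangle) auto
  also have "\<dots> \<le> nrm (x i) + (\<Sum>i\<in>I. nrm (x i))" using insert by simp
  finally show ?case using insert by simp
qed

text \<open>At almost every point at most one \<open>x i\<close> is nonzero, so there the rescaled
  sum is at most \<open>R\<close> times the original one in absolute value, and the ideal property
  applies. This is unconditionality with constant 1.\<close>

lemma nrm_disjoint_scale_le:
  assumes fin: "finite I" and x: "\<And>i. i \<in> I \<Longrightarrow> x i \<in> X"
    and disj: "\<And>i j. i \<in> I \<Longrightarrow> j \<in> I \<Longrightarrow> i \<noteq> j \<Longrightarrow> AE t in unit_lebesgue. x i t = 0 \<or> x j t = 0"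
    and r: "\<And>i. i \<in> I \<Longrightarrow> \<bar>r i\<bar> \<le> R" and R: "0 \<le> R"
  shows "nrm (\<lambda>t. \<Sum>i\<in>I. r i * x i t) \<le> R * nrm (\<lambda>t. \<Sum>i\<in>I. x i t)"
proof -
  have "AE t in unit_lebesgue. \<forall>i\<in>I. \<forall>j\<in>I. i \<noteq> j \<longrightarrow> x i t = 0 \<or> x j t = 0"
    using fin disj by (intro AE_finite_allI) auto
  then have "AE t in unit_lebesgue. \<bar>\<Sum>i\<in>I. r i * x i t\<bar> \<le> \<bar>R * (\<Sum>i\<in>I. x i t)\<bar>"
  proof eventually_elim
    case (elim t)
    show ?case
    proof (cases "\<exists>i\<in>I. x i t \<noteq> 0")
      case True
      then obtain i where i: "i \<in> I" "x i t \<noteq> 0" by auto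
      then have "j \<noteq> i \<Longrightarrow> x j t = 0" if "j \<in> I" for j using elim that by blast
      then have "(\<Sum>i\<in>I. r i * x i t) = r i * x i t" "(\<Sum>i\<in>I. x i t) = x i t"
        using fin i(1) by (auto simp: sum.remove[of I i])
      then show ?thesis using r[OF i(1)] R by (simp add: abs_mult mult_right_mono)
    next
      case False
      then show ?thesis by simp
    qed
  qed
  moreover have "(\<lambda>t. \<Sum>i\<in>I. x i t) \<in> X" using fin x by (rule sum_mem)
  moreover have "(\<lambda>t. \<Sum>i\<in>I. r i * x i t) \<in> X" using fin x by (intro sum_mem scale) auto
  ultimately have "nrm (\<lambda>t. \<Sum>i\<in>I. r i * x i t) \<le> nrm (\<lambda>t. R * (\<Sum>i\<in>I. x i t))"
    by (intro ideal[THEN conjunct2] borel scale)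
  also have "\<dots> = R * nrm (\<lambda>t. \<Sum>i\<in>I. x i t)"
    using nrm_scale[OF sum_mem[OF fin x]] R by simp
  finally show ?thesis .
qed

section \<open>Indicators and step functions under equimeasurability\<close>

lemma indicator_nrm_cong:
  assumes "A \<in> sets unit_lebesgue" "B \<in> sets unit_lebesgue" "indicat_real A \<in> X"
    "measure unit_lebesgue A = measure unit_lebesgue B"
  shows "indicat_real B \<in> X" "nrm (indicat_real B) = nrm (indicat_real A)"
proof -
  have eq: "{t\<in>{0..1}. \<bar>indicat_real E t\<bar> > s} = (if s < 1 then E else {})"
    if "E \<in> sets unit_lebesgue" "s \<ge> 0" for E s
    using that by (auto simp: sets_unit_lebesgue_iff indicator_def)
  have "indicat_real B \<in> X \<and> nrm (indicat_real B) = nrm (indicat_real A)"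
    by (rule symmetric[OF assms(3)]) (use assms in \<open>simp_all only: eq borel_measurable_indicator split: if_split, auto\<close>)
  then show "indicat_real B \<in> X" "nrm (indicat_real B) = nrm (indicat_real A)" by auto
qed

text \<open>A function that is positive almost everywhere exceeds some
  \<open>1 / real (Suc n)\<close> on a set \<open>F n\<close> of positive measure. The ideal
  property puts indicators of subsets of \<open>F n\<close> into \<open>X\<close>, and symmetry
  transfers this to every set no larger in measure than \<open>F n\<close>.\<close>

lemma exists_small_indicators:
  "\<exists>d>0. \<forall>E\<in>sets unit_lebesgue. measure unit_lebesgue E \<le> d \<longrightarrow> indicat_real E \<in> X"
proof -
  obtain x where x: "x \<in> X" "AE t in unit_lebesgue. x t > 0" using full_support by blast
  have [measurable]: "x \<in> borel_measurable unit_lebesgue" using x(1) by (rule borel)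
  define F where "F n = {t \<in> {0..1}. x t > 1 / real (Suc n)}" for n
  have F: "F n \<in> sets unit_lebesgue" for n
  proof -
    have "{t \<in> space unit_lebesgue. x t > 1 / real (Suc n)} \<in> sets unit_lebesgue" by measurable
    then show ?thesis by (simp add: F_def)
  qed
  have "\<exists>n. \<not> (AE t in unit_lebesgue. \<not> x t > 1 / real (Suc n))"
  proof (rule ccontr)
    assume "\<not> ?thesis"
    then have "AE t in unit_lebesgue. \<forall>n. \<not> x t > 1 / real (Suc n)" by (simp add: AE_all_countable)
    then have "AE t in unit_lebesgue. False"
      using x(2) by eventually_elim (metis nat_approx_posE)
    then have "emeasure unit_lebesgue (space unit_lebesgue) = 0"
      by (metis ae_filter_eq_bot_iff trivial_limit_def)
    then show False by (simp add: emeasure_restrict_space)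
  qed
  then obtain n where "\<not> (AE t in unit_lebesgue. \<not> x t > 1 / real (Suc n))" by blast
  then have pos: "0 < measure unit_lebesgue (F n)"
    using not_AE_imp_measure_pos[of "\<lambda>t. x t > 1 / real (Suc n)"] F[of n] by (simp add: F_def)
  have FX: "indicat_real E \<in> X" if "E \<in> sets unit_lebesgue" "E \<subseteq> F n" for E
  proof -
    have "\<bar>indicat_real E t\<bar> \<le> \<bar>real (Suc n) * x t\<bar>" for t
    proof (cases "t \<in> E")
      case True
      then have "1 / real (Suc n) < x t" using that by (auto simp: F_def)
      then have "1 < real (Suc n) * x t" by (simp add: field_simps)
      then show ?thesis using True by simp
    qed simp
    then show ?thesis
      using that by (intro ideal[THEN conjunct1, OF scale[OF x(1), of "real (Suc n)"]]) auto
  qed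
  have "indicat_real E \<in> X" if E: "E \<in> sets unit_lebesgue" "measure unit_lebesgue E \<le> measure unit_lebesgue (F n)" for E
  proof -
    obtain E' where "E' \<in> sets unit_lebesgue" "E' \<subseteq> F n" "measure unit_lebesgue E' = measure unit_lebesgue E"
      using exists_subset_of_measure[OF F, of "measure unit_lebesgue E" n] E by auto
    then show ?thesis using indicator_nrm_cong(1)[of E' E] FX E by auto
  qed
  then show ?thesis using pos by blast
qed

lemma nrm_indicator_pos:
  assumes "E \<in> sets unit_lebesgue" "0 < measure unit_lebesgue E" "indicat_real E \<in> X"
  shows "0 < nrm (indicat_real E)"
proof -
  have "\<not> (AE t in unit_lebesgue. indicat_real E t = 0)"
  proof
    assume "AE t in unit_lebesgue. indicat_real E t = 0"
    then have "AE t in unit_lebesgue. t \<notin> E" by eventually_elim (simp add: indicator_def split: if_splits)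
    then have "emeasure unit_lebesgue E = 0"
      using assms(1) sets.sets_into_space[OF assms(1)] by (subst (asm) AE_iff_measurable[of E]) auto
    then show False using assms(2) by (simp add: measure_def)
  qed
  then show ?thesis using nrm_eq_0_iff[OF assms(3)] nrm_nonneg[OF assms(3)] by auto
qed

text \<open>For disjoint sets the part where the step function exceeds \<open>s\<close> in absolute
  value is the union of the sets with \<open>\<bar>c i\<bar> > s\<close>. The distribution function
  thus depends only on the coefficients and the measures, and symmetry applies.\<close>

lemma nrm_step_function_cong:
  assumes fin: "finite I"
    and E: "\<And>i. i \<in> I \<Longrightarrow> E i \<in> sets unit_lebesgue" "disjoint_family_on E I" "\<And>i. i \<in> I \<Longrightarrow> indicat_real (E i) \<in> X"
    and F: "\<And>i. i \<in> I \<Longrightarrow> F i \<in> sets unit_lebesgue" "disjoint_family_on F I"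
    and eq: "\<And>i. i \<in> I \<Longrightarrow> measure unit_lebesgue (E i) = measure unit_lebesgue (F i)"
  shows "nrm (\<lambda>t. \<Sum>i\<in>I. c i * indicat_real (F i) t) = nrm (\<lambda>t. \<Sum>i\<in>I. c i * indicat_real (E i) t)"
proof -
  have meas: "measure unit_lebesgue {t\<in>{0..1}. \<bar>\<Sum>i\<in>I. c i * indicat_real (G i) t\<bar> > s}
      = (\<Sum>i\<in>{i\<in>I. \<bar>c i\<bar> > s}. measure unit_lebesgue (G i))"
    if G: "\<And>i. i \<in> I \<Longrightarrow> G i \<in> sets unit_lebesgue" "disjoint_family_on G I" and s: "s \<ge> 0" for G s
  proof -
    have val: "(\<Sum>i\<in>I. c i * indicat_real (G i) t) = c k" if "k \<in> I" "t \<in> G k" for k t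
    proof -
      have "j \<in> I \<Longrightarrow> j \<noteq> k \<Longrightarrow> t \<notin> G j" for j
        using that G(2) by (auto simp: disjoint_family_on_def)
      then have "(\<Sum>i\<in>I. c i * indicat_real (G i) t) = (\<Sum>i\<in>I. if i = k then c i else 0)"
        using that by (intro sum.cong) auto
      then show ?thesis using fin that by simp
    qed
    have zero: "(\<Sum>i\<in>I. c i * indicat_real (G i) t) = 0" if "\<And>k. k \<in> I \<Longrightarrow> t \<notin> G k" for t
      using that by simp
    have "{t\<in>{0..1}. \<bar>\<Sum>i\<in>I. c i * indicat_real (G i) t\<bar> > s} = (\<Union>i\<in>{i\<in>I. \<bar>c i\<bar> > s}. G i)" (is "?L = ?R")
    proof (intro set_eqI iffI)
      fix t assume t: "t \<in> ?L"
      then obtain k where "k \<in> I" "t \<in> G k" using zero[of t] s by fastforce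
      then show "t \<in> ?R" using t val[of k t] by auto
    next
      fix t assume "t \<in> ?R"
      then obtain k where "k \<in> I" "t \<in> G k" "s < \<bar>c k\<bar>" by auto
      then show "t \<in> ?L" using G(1)[of k] val[of k t] by (auto simp: sets_unit_lebesgue_iff)
    qed
    then show ?thesis
      using G fin by (auto intro!: unit_lebesgue.finite_measure_finite_Union elim: disjoint_family_on_mono[rotated])
  qed
  have "(\<lambda>t. \<Sum>i\<in>I. c i * indicat_real (F i) t) \<in> borel_measurable unit_lebesgue"
    using F(1) by (intro borel_measurable_sum borel_measurable_times borel_measurable_indicator) auto
  moreover have "(\<lambda>t. \<Sum>i\<in>I. c i * indicat_real (E i) t) \<in> X"
    using fin E(3) by (intro sum_mem scale)
  ultimately show ?thesis
    by (intro symmetric[THEN conjunct2]) (simp_all only: meas[OF E(1,2)] meas[OF F], simp add: eq)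
qed

section \<open>Separated families as unconditional sequences\<close>

lemma admissible_AE_disjoint:
  assumes "weight w" "admissible w n x" "i \<in> {1..n}" "j \<in> {1..n}" "i \<noteq> j"
  shows "AE t in unit_lebesgue. x i t = 0 \<or> x j t = 0"
proof -
  have "sep w (fsupp (x i)) (fsupp (x j)) \<or> sep w (fsupp (x j)) (fsupp (x i))"
    using assms by (cases "i < j") (auto simp: admissible_def)
  then have "AE t in unit_lebesgue. \<not> (t \<in> fsupp (x i) \<and> t \<in> fsupp (x j))"
  proof
    assume "sep w (fsupp (x j)) (fsupp (x i))"
    then show ?thesis
      by (intro eventually_mono[OF sep_imp_AE_disjoint[OF assms(1), of "fsupp (x j)" "fsupp (x i)"]]) auto
  qed (rule sep_imp_AE_disjoint[OF assms(1)])
  moreover have "AE t in unit_lebesgue. t \<in> {0..1}"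
    by (rule AE_I2) simp
  ultimately show ?thesis by eventually_elim (auto simp: fsupp_def)
qed

lemma admissible_scale:
  assumes "admissible w n x"
  shows "admissible w n (\<lambda>i t. r i * x i t)"
proof -
  have "fsupp (\<lambda>t. r i * x i t) \<subseteq> fsupp (x i)" for i by (auto simp: fsupp_def)
  then show ?thesis
    using assms unfolding admissible_def by (blast intro: scale sep_mono)
qed

lemma admissible_scale_le:
  assumes "weight w" "admissible w n x" "\<And>i. i \<in> {1..n} \<Longrightarrow> \<bar>r i\<bar> \<le> R" "0 \<le> R"
  shows "nrm (\<lambda>t. \<Sum>i=1..n. r i * x i t) \<le> R * nrm (\<lambda>t. \<Sum>i=1..n. x i t)"
  using assms admissible_AE_disjoint[OF assms(1,2)]
  by (intro nrm_disjoint_scale_le) (auto simp: admissible_def)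

text \<open>Rescaling the family \<open>r i * x i\<close> by the inverse factors, which are at most
  \<open>inverse R\<close>, recovers \<open>x\<close>; so this is the upper bound read
  backwards.\<close>

lemma admissible_scale_ge:
  assumes "weight w" "admissible w n x" "\<And>i. i \<in> {1..n} \<Longrightarrow> R \<le> r i" "0 < R"
  shows "R * nrm (\<lambda>t. \<Sum>i=1..n. x i t) \<le> nrm (\<lambda>t. \<Sum>i=1..n. r i * x i t)"
proof -
  have r: "0 < r i" if "i \<in> {1..n}" for i using assms(3)[OF that] assms(4) by simp
  have "nrm (\<lambda>t. \<Sum>i=1..n. inverse (r i) * (r i * x i t)) \<le> inverse R * nrm (\<lambda>t. \<Sum>i=1..n. r i * x i t)"
  proof (rule admissible_scale_le[OF assms(1) admissible_scale[OF assms(2)]])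
    show "\<bar>inverse (r i)\<bar> \<le> inverse R" if "i \<in> {1..n}" for i
      using r[OF that] assms(3)[OF that] assms(4) by (simp add: le_imp_inverse_le)
  qed (use assms(4) in simp)
  moreover have "(\<Sum>i=1..n. inverse (r i) * (r i * x i t)) = (\<Sum>i=1..n. x i t)" for t
    using r by (intro sum.cong refl) (metis left_inverse less_irrefl mult.assoc mult_1)
  ultimately show ?thesis using assms(4) by (simp add: field_simps)
qed

text \<open>Coefficients 0 and 1 cut a single member out of the sum.\<close>

lemma admissible_component_le:
  assumes "weight w" "admissible w n x" "k \<in> {1..n}"
  shows "nrm (x k) \<le> nrm (\<lambda>t. \<Sum>i=1..n. x i t)"
proof -
  have "nrm (\<lambda>t. \<Sum>i=1..n. (if i = k then 1 else 0) * x i t) \<le> 1 * nrm (\<lambda>t. \<Sum>i=1..n. x i t)"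
    using assms by (intro admissible_scale_le) auto
  moreover have "(\<Sum>i=1..n. (if i = k then 1 else 0) * x i t) = x k t" for t
    using assms(3) by (simp add: if_distrib[of "\<lambda>a. a * _"] cong: if_cong)
  ultimately show ?thesis by simp
qed

text \<open>The supports are disjoint only up to null sets. Removing the overlaps does not change
  their measures, and pieces of measure \<open>d\<close> are then cut from what remains. Members of
  norm 0 get null pieces, since their supports are null.\<close>

lemma exists_disjoint_pieces:
  assumes w: "weight w" and x: "admissible w n x"
    and d: "0 \<le> d" "\<And>i. i \<in> {1..n} \<Longrightarrow> nrm (x i) \<noteq> 0 \<Longrightarrow> d \<le> measure unit_lebesgue (fsupp (x i))"
  shows "\<exists>E. disjoint_family_on E {1..n} \<and> (\<forall>i\<in>{1..n}. E i \<in> sets unit_lebesgue \<and> E i \<subseteq> fsupp (x i) \<and>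
    measure unit_lebesgue (E i) = (if nrm (x i) = 0 then 0 else d))"
proof -
  define G where "G i = fsupp (x i) - (\<Union>j\<in>{1..n}-{i}. fsupp (x j))" for i
  have fs: "fsupp (x i) \<in> sets unit_lebesgue" if "i \<in> {1..n}" for i
    using x that by (intro fsupp_sets) (auto simp: admissible_def)
  then have G: "G i \<in> sets unit_lebesgue" if "i \<in> {1..n}" for i
    using that unfolding G_def by (intro sets.Diff sets.finite_UN) auto
  have mG: "measure unit_lebesgue (G i) = measure unit_lebesgue (fsupp (x i))" if i: "i \<in> {1..n}" for i
  proof (rule measure_eq_AE)
    have "AE t in unit_lebesgue. \<forall>j\<in>{1..n}-{i}. x i t = 0 \<or> x j t = 0"
      using admissible_AE_disjoint[OF w x i] by (intro AE_finite_allI) auto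
    then show "AE t in unit_lebesgue. t \<in> G i \<longleftrightarrow> t \<in> fsupp (x i)"
      by eventually_elim (auto simp: G_def fsupp_def)
  qed (use G fs i in auto)
  have "\<exists>E \<in> sets unit_lebesgue. E \<subseteq> G i \<and> measure unit_lebesgue E = (if nrm (x i) = 0 then 0 else d)"
    if "i \<in> {1..n}" for i
    using that d mG G by (intro exists_subset_of_measure) auto
  then obtain E where E: "\<And>i. i \<in> {1..n} \<Longrightarrow> E i \<in> sets unit_lebesgue \<and> E i \<subseteq> G i \<and>
      measure unit_lebesgue (E i) = (if nrm (x i) = 0 then 0 else d)"
    by metis
  have "E i \<inter> E j = {}" if "i \<in> {1..n}" "j \<in> {1..n}" "i \<noteq> j" for i j
    using E[OF that(1)] E[OF that(2)] that unfolding G_def by blast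
  then have "disjoint_family_on E {1..n}" by (simp add: disjoint_family_on_def)
  moreover have "G i \<subseteq> fsupp (x i)" for i by (auto simp: G_def)
  ultimately show ?thesis using E by (intro exI[of _ E]) blast
qed

end

text \<open>Induction on \<open>n\<close>, keeping all sets inside one \<open>band l u\<close> with
  \<open>0 < l\<close>. Non-triviality always supplies a further band of positive measure, either
  above \<open>2 * u\<close> or below \<open>l / 2\<close>, hence separated from everything chosen
  before.\<close>

lemma nontrivial_weight_separated_sets:
  fixes n :: nat
  assumes "nontrivial_weight w"
  shows "\<exists>G. (\<forall>i\<in>{1..n}. G i \<in> sets unit_lebesgue \<and> 0 < measure unit_lebesgue (G i)) \<and>
    (\<forall>i j. 1 \<le> i \<and> i < j \<and> j \<le> n \<longrightarrow> sep w (G i) (G j))"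
proof -
  have wm[measurable]: "w \<in> borel_measurable unit_lebesgue" and w0: "AE t in unit_lebesgue. w t > 0"
    using assms by (auto simp: nontrivial_weight_def weight_def)
  define band where "band a b = {t \<in> {0..1}. a \<le> w t \<and> w t \<le> b}" for a b
  have band: "band a b \<in> sets unit_lebesgue" for a b
  proof -
    have "{t \<in> space unit_lebesgue. a \<le> w t \<and> w t \<le> b} \<in> sets unit_lebesgue" by measurable
    then show ?thesis by (simp add: band_def)
  qed
  have sep_band: "sep w A B" if "A \<subseteq> band a b" "B \<subseteq> band a' b'" "2 * b' \<le> a" for A B a b a' b'
    unfolding sep_def
  proof (intro exI[of _ "ereal b'"] conjI AE_I2 impI)
    fix t assume "t \<in> A"
    then have "2 * b' \<le> w t" using that by (auto simp: band_def)
    then show "2 * ereal b' \<le> ereal (w t)" by (metis ereal_less_eq(3) numeral_eq_ereal times_ereal.simps(1))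
  qed (use that in \<open>auto simp: band_def\<close>)
  have band_pos: "0 < measure unit_lebesgue (band a b)"
    if "\<not> (AE t in unit_lebesgue. \<not> (a \<le> w t \<and> w t \<le> b))" for a b
    using not_AE_imp_measure_pos[OF band[unfolded band_def] that] by (simp add: band_def)
  have step: "\<exists>a b. 0 < a \<and> 0 < measure unit_lebesgue (band a b) \<and> (2 * u \<le> a \<or> 2 * b \<le> l)"
    if "0 < l" "0 < u" for l u
  proof (cases "\<exists>B. AE t in unit_lebesgue. w t \<le> B")
    case False
    have "\<exists>k::nat. 0 < measure unit_lebesgue (band (2 * u) (real k))"
    proof (rule ccontr)
      assume "\<not> ?thesis"
      then have "AE t in unit_lebesgue. \<forall>k::nat. \<not> (2 * u \<le> w t \<and> w t \<le> real k)"
        unfolding AE_all_countable using band_pos by blast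
      then have "AE t in unit_lebesgue. w t \<le> 2 * u"
        by eventually_elim (metis linear real_arch_simple)
      then show False using False by blast
    qed
    then show ?thesis using that by (meson less_imp_le mult_pos_pos order_refl zero_less_numeral)
  next
    case True
    then have nb: "\<not> (\<exists>B. AE t in unit_lebesgue. 1 / w t \<le> B)"
      using assms by (auto simp: nontrivial_weight_def)
    \<comment> \<open>As \<open>w\<close> is positive almost everywhere, these bands exhaust the
      part where \<open>w \<le> l / 2\<close>. Were they all null, \<open>1 / w\<close> would be
      bounded by \<open>2 / l\<close>. The positive left end keeps the new \<open>l\<close>
      positive.\<close>
    have "\<exists>k::nat. 0 < measure unit_lebesgue (band (1 / real (Suc k)) (l / 2))"
    proof (rule ccontr)
      assume "\<not> ?thesis"
      then have "AE t in unit_lebesgue. \<forall>k::nat. \<not> (1 / real (Suc k) \<le> w t \<and> w t \<le> l / 2)"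
        unfolding AE_all_countable using band_pos by blast
      then have "AE t in unit_lebesgue. 1 / w t \<le> 2 / l"
        using w0
      proof eventually_elim
        case (elim t)
        then obtain k where "1 / real (Suc k) < w t" using nat_approx_posE by blast
        then have "l / 2 < w t" using elim by (meson less_imp_le not_le)
        then show ?case using that elim by (simp add: field_simps)
      qed
      then show False using nb by blast
    qed
    then obtain k where "0 < measure unit_lebesgue (band (1 / real (Suc k)) (l / 2))" by blast
    then show ?thesis
      by (intro exI[of _ "1 / real (Suc k)"] exI[of _ "l / 2"]) auto
  qed
  have "\<exists>G l u. 0 < l \<and> 0 < u \<and> (\<forall>i\<in>{1..n}. G i \<in> sets unit_lebesgue \<and> 0 < measure unit_lebesgue (G i) \<and> G i \<subseteq> band l u) \<and>
    (\<forall>i j. 1 \<le> i \<and> i < j \<and> j \<le> n \<longrightarrow> sep w (G i) (G j))"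
  proof (induction n)
    case 0
    show ?case by (intro exI[of _ "\<lambda>_. {}"] exI[of _ 1]) auto
  next
    case (Suc n)
    then obtain G l u where lu: "0 < l" "0 < u"
      and G: "\<And>i. i \<in> {1..n} \<Longrightarrow> G i \<in> sets unit_lebesgue \<and> 0 < measure unit_lebesgue (G i) \<and> G i \<subseteq> band l u"
      and S: "\<And>i j. 1 \<le> i \<Longrightarrow> i < j \<Longrightarrow> j \<le> n \<Longrightarrow> sep w (G i) (G j)" by blast
    obtain a b where ab: "0 < a" "0 < measure unit_lebesgue (band a b)" "2 * u \<le> a \<or> 2 * b \<le> l"
      using step[OF lu] by blast
    define l' u' where "l' = min l a" and "u' = max u b"
    have lu': "0 < l'" "0 < u'" using lu ab by (auto simp: l'_def u'_def)
    have sub: "band l u \<subseteq> band l' u'" "band a b \<subseteq> band l' u'"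
      by (auto simp: band_def l'_def u'_def)
    show ?case
    proof (cases "2 * b \<le> l")
      case True
      define H where "H i = (if i \<le> n then G i else band a b)" for i
      have "\<forall>i\<in>{1..Suc n}. H i \<in> sets unit_lebesgue \<and> 0 < measure unit_lebesgue (H i) \<and> H i \<subseteq> band l' u'"
      proof
        fix i assume i: "i \<in> {1..Suc n}"
        show "H i \<in> sets unit_lebesgue \<and> 0 < measure unit_lebesgue (H i) \<and> H i \<subseteq> band l' u'"
        proof (cases "i \<le> n")
          case True
          then show ?thesis using G[of i] i sub(1) by (simp add: H_def) blast
        next
          case False
          then show ?thesis using ab(2) band sub(2) by (simp add: H_def)
        qed
      qed
      moreover have "sep w (H i) (H j)" if "1 \<le> i" "i < j" "j \<le> Suc n" for i j
      proof (cases "j \<le> n")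
        case True
        then show ?thesis using that S[of i j] by (simp add: H_def)
      next
        case False
        then have "H i = G i" "H j = band a b" "i \<in> {1..n}" using that by (auto simp: H_def)
        then show ?thesis using sep_band[OF _ _ \<open>2 * b \<le> l\<close>, of "H i" u "H j" a] G[of i] by simp
      qed
      ultimately show ?thesis using lu' by blast
    next
      case False
      then have ua: "2 * u \<le> a" using ab by simp
      \<comment> \<open>Large values of \<open>w\<close> come first in a separated family, so a band
        above the old range becomes member 1 and the old sets move up by one index.\<close>
      define H where "H i = (if i = 1 then band a b else G (i - 1))" for i :: nat
      have "\<forall>i\<in>{1..Suc n}. H i \<in> sets unit_lebesgue \<and> 0 < measure unit_lebesgue (H i) \<and> H i \<subseteq> band l' u'"
      proof
        fix i assume i: "i \<in> {1..Suc n}"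
        show "H i \<in> sets unit_lebesgue \<and> 0 < measure unit_lebesgue (H i) \<and> H i \<subseteq> band l' u'"
        proof (cases "i = 1")
          case True
          then show ?thesis using ab(2) band sub by (simp add: H_def)
        next
          case False
          then have "i - 1 \<in> {1..n}" using i by auto
          then show ?thesis using False G[of "i - 1"] sub(1) by (simp add: H_def) blast
        qed
      qed
      moreover have "sep w (H i) (H j)" if "1 \<le> i" "i < j" "j \<le> Suc n" for i j
      proof (cases "i = 1")
        case True
        then have "H i = band a b" "H j = G (j - 1)" "j - 1 \<in> {1..n}" using that by (auto simp: H_def)
        then show ?thesis using sep_band[OF _ _ ua, of "H i" b "H j" l] G[of "j - 1"] by simp
      next
        case False
        then show ?thesis using that S[of "i - 1" "j - 1"] by (simp add: H_def)
      qed
      ultimately show ?thesis using lu' by blast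
    qed
  qed
  then show ?thesis by blast
qed

section \<open>Decomposable spaces\<close>

locale decomposable_space = symmetric_space +
  fixes w :: "real \<Rightarrow> real" and C :: real
  assumes nontrivial: "nontrivial_weight w"
    and C_pos: "0 < C"
    and decomposable: "\<And>n x y. 1 \<le> n \<Longrightarrow>
        \<forall>i\<in>{1..n}. x i \<in> X \<and> y i \<in> X \<and> nrm (x i) = nrm (y i) \<Longrightarrow>
        w_separated w n (\<lambda>i. fsupp (x i) \<union> fsupp (y i)) \<Longrightarrow>
        inverse C * nrm (\<lambda>t. \<Sum>i=1..n. x i t) \<le> nrm (\<lambda>t. \<Sum>i=1..n. y i t) \<and>
        nrm (\<lambda>t. \<Sum>i=1..n. y i t) \<le> C * nrm (\<lambda>t. \<Sum>i=1..n. x i t)"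
begin

section \<open>Comparison of separated families with equal norms\<close>

lemma weight: "weight w"
  using nontrivial by (simp add: nontrivial_weight_def)

text \<open>The union of the two supports is just \<open>fsupp (x i)\<close>, so the separation of
  \<open>x\<close> alone licenses decomposability for the pair.\<close>

lemma compare_pieces:
  assumes "1 \<le> n" "admissible w n x" "\<And>i. i \<in> {1..n} \<Longrightarrow> u i \<in> X"
    "\<And>i. i \<in> {1..n} \<Longrightarrow> fsupp (u i) \<subseteq> fsupp (x i)" "\<And>i. i \<in> {1..n} \<Longrightarrow> nrm (u i) = nrm (x i)"
  shows "nrm (\<lambda>t. \<Sum>i=1..n. x i t) \<le> C * nrm (\<lambda>t. \<Sum>i=1..n. u i t)"
    and "nrm (\<lambda>t. \<Sum>i=1..n. u i t) \<le> C * nrm (\<lambda>t. \<Sum>i=1..n. x i t)"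
proof -
  have x: "\<forall>i\<in>{1..n}. x i \<in> X" "w_separated w n (\<lambda>i. fsupp (x i))"
    using assms(2) admissible_iff_w_separated[OF weight] by auto
  have un: "fsupp (x i) \<union> fsupp (u i) = fsupp (x i)" if "i \<in> {1..n}" for i
    using assms(4)[OF that] by blast
  have "w_separated w n (\<lambda>i. fsupp (x i) \<union> fsupp (u i))"
    using x(2) unfolding w_separated_def by (auto simp: un)
  then have "inverse C * nrm (\<lambda>t. \<Sum>i=1..n. x i t) \<le> nrm (\<lambda>t. \<Sum>i=1..n. u i t) \<and>
      nrm (\<lambda>t. \<Sum>i=1..n. u i t) \<le> C * nrm (\<lambda>t. \<Sum>i=1..n. x i t)"
    using assms x by (intro decomposable) auto
  then show "nrm (\<lambda>t. \<Sum>i=1..n. x i t) \<le> C * nrm (\<lambda>t. \<Sum>i=1..n. u i t)"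
    and "nrm (\<lambda>t. \<Sum>i=1..n. u i t) \<le> C * nrm (\<lambda>t. \<Sum>i=1..n. x i t)"
    using C_pos by (auto simp: field_simps)
qed

text \<open>One factor \<open>C\<close> for each passage between a family and its step functions;
  the maximum with 1 ensures \<open>K \<le> K\<^sup>2\<close>.\<close>

definition K :: real where "K = max 1 (C * C)"

lemma K_ge_1: "1 \<le> K" by (simp add: K_def)

text \<open>The families \<open>x\<close> and \<open>y\<close> need not be separated from each
  other, so decomposability cannot be applied to this pair. The detour goes from \<open>x\<close> to
  step functions on sets \<open>E i\<close> inside its supports, from there by symmetry to the same
  step functions on sets \<open>F i\<close> inside the supports of \<open>y\<close>, and back to
  \<open>y\<close>.\<close>

lemma compare_families:
  assumes x: "admissible w n x" and y: "admissible w n y"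
    and eq: "\<And>i. i \<in> {1..n} \<Longrightarrow> nrm (x i) = nrm (y i)"
  shows "nrm (\<lambda>t. \<Sum>i=1..n. x i t) \<le> K * nrm (\<lambda>t. \<Sum>i=1..n. y i t)"
proof (cases "n = 0")
  case True
  then show ?thesis by (simp add: nrm_zero)
next
  case False
  then have n: "1 \<le> n" by simp
  have xX: "x i \<in> X" and yX: "y i \<in> X" if "i \<in> {1..n}" for i
    using x y that by (auto simp: admissible_def)
  define I where "I = {i\<in>{1..n}. nrm (x i) \<noteq> 0}"
  obtain d0 where d0: "d0 > 0" "\<And>E. E \<in> sets unit_lebesgue \<Longrightarrow> measure unit_lebesgue E \<le> d0 \<Longrightarrow> indicat_real E \<in> X"
    using exists_small_indicators by blast
  have pos: "0 < measure unit_lebesgue (fsupp z)" if "z \<in> X" "nrm z \<noteq> 0" for z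
  proof -
    have "\<not> (AE t in unit_lebesgue. \<not> z t \<noteq> 0)" using that nrm_eq_0_iff by simp
    then show ?thesis
      using not_AE_imp_measure_pos[of "\<lambda>t. z t \<noteq> 0"] fsupp_sets[OF that(1)] by (simp add: fsupp_def)
  qed
  \<comment> \<open>The common measure \<open>d\<close> must fit into every support of a member of
    nonzero norm and be small enough for the indicators to lie in \<open>X\<close>; the minimum of
    these finitely many positive numbers does both.\<close>
  define D where "D = insert d0 ((\<lambda>i. measure unit_lebesgue (fsupp (x i))) ` I \<union> (\<lambda>i. measure unit_lebesgue (fsupp (y i))) ` I)"
  define d where "d = Min D"
  have fin: "finite D" "D \<noteq> {}" by (auto simp: D_def I_def)
  have "\<forall>a\<in>D. 0 < a" using d0 pos xX yX eq by (auto simp: D_def I_def)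
  then have d: "0 < d" unfolding d_def using fin by simp
  have dle: "d \<le> a" if "a \<in> D" for a unfolding d_def using fin that by simp
  have dx: "d \<le> measure unit_lebesgue (fsupp (x i))" and dy: "d \<le> measure unit_lebesgue (fsupp (y i))"
    if "i \<in> {1..n}" "nrm (x i) \<noteq> 0" for i
    using that by (auto intro!: dle simp: D_def I_def)
  obtain E where E: "disjoint_family_on E {1..n}"
    "\<And>i. i \<in> {1..n} \<Longrightarrow> E i \<in> sets unit_lebesgue" "\<And>i. i \<in> {1..n} \<Longrightarrow> E i \<subseteq> fsupp (x i)"
    "\<And>i. i \<in> {1..n} \<Longrightarrow> measure unit_lebesgue (E i) = (if nrm (x i) = 0 then 0 else d)"
    using exists_disjoint_pieces[OF weight x _ dx] d by (metis less_imp_le)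
  obtain F where F: "disjoint_family_on F {1..n}"
    "\<And>i. i \<in> {1..n} \<Longrightarrow> F i \<in> sets unit_lebesgue" "\<And>i. i \<in> {1..n} \<Longrightarrow> F i \<subseteq> fsupp (y i)"
    "\<And>i. i \<in> {1..n} \<Longrightarrow> measure unit_lebesgue (F i) = (if nrm (x i) = 0 then 0 else d)"
    using exists_disjoint_pieces[OF weight y, of d] d dy eq by (metis less_imp_le)
  have dd0: "d \<le> d0" using dle by (simp add: D_def)
  have EX: "indicat_real (E i) \<in> X" and FX: "indicat_real (F i) \<in> X" if "i \<in> {1..n}" for i
    using d0 dd0 E(2,4)[OF that] F(2,4)[OF that] by auto
  \<comment> \<open>This scales the indicator to the norm of \<open>x i\<close>. If that norm is 0,
    then \<open>c i = 0\<close> and the step function vanishes, whatever the denominator.\<close>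
  define c where "c i = nrm (x i) / nrm (indicat_real (E i))" for i
  have FE: "nrm (indicat_real (F i)) = nrm (indicat_real (E i))" if "i \<in> {1..n}" for i
    using that E F EX by (intro indicator_nrm_cong(2)) auto
  have nE: "nrm (\<lambda>t. c i * indicat_real (E i) t) = nrm (x i)" if "i \<in> {1..n}" for i
  proof (cases "nrm (x i) = 0")
    case True
    then show ?thesis by (simp add: c_def nrm_zero)
  next
    case False
    then have "0 < nrm (indicat_real (E i))"
      using E(2,4)[OF that] EX[OF that] d by (intro nrm_indicator_pos) auto
    then show ?thesis
      using nrm_nonneg[OF xX[OF that]] by (subst nrm_scale[OF EX[OF that]]) (simp add: c_def)
  qed
  have nF: "nrm (\<lambda>t. c i * indicat_real (F i) t) = nrm (y i)" if "i \<in> {1..n}" for i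
    using nE[OF that] nrm_scale[OF EX[OF that]] nrm_scale[OF FX[OF that]] FE[OF that] eq[OF that] by simp
  have fsupp_indicator: "fsupp (\<lambda>t. a * indicat_real A t) \<subseteq> A" for a A
    by (auto simp: fsupp_def indicator_def)
  have fE: "fsupp (\<lambda>t. c i * indicat_real (E i) t) \<subseteq> fsupp (x i)"
    and fF: "fsupp (\<lambda>t. c i * indicat_real (F i) t) \<subseteq> fsupp (y i)" if "i \<in> {1..n}" for i
    using E(3)[OF that] F(3)[OF that] fsupp_indicator by blast+
  have "nrm (\<lambda>t. \<Sum>i=1..n. x i t) \<le> C * nrm (\<lambda>t. \<Sum>i=1..n. c i * indicat_real (E i) t)"
    using EX nE fE by (intro compare_pieces(1) n x scale)
  also have "nrm (\<lambda>t. \<Sum>i=1..n. c i * indicat_real (E i) t) = nrm (\<lambda>t. \<Sum>i=1..n. c i * indicat_real (F i) t)"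
    using E F EX FX by (intro nrm_step_function_cong) auto
  also have "\<dots> \<le> C * nrm (\<lambda>t. \<Sum>i=1..n. y i t)"
    using FX nF fF by (intro compare_pieces(2) n y scale)
  finally have "nrm (\<lambda>t. \<Sum>i=1..n. x i t) \<le> C * C * nrm (\<lambda>t. \<Sum>i=1..n. y i t)"
    using C_pos by simp
  also have "\<dots> \<le> K * nrm (\<lambda>t. \<Sum>i=1..n. y i t)"
    using yX by (intro mult_right_mono nrm_nonneg sum_mem) (auto simp: K_def)
  finally show ?thesis .
qed

text \<open>Normalised indicators of small pieces of the separated sets that a non-trivial weight
  provides.\<close>

lemma exists_unit_family: "\<exists>x. admissible w n x \<and> (\<forall>i\<in>{1..n}. nrm (x i) = 1)"
proof -
  obtain G where G: "\<And>i. i \<in> {1..n} \<Longrightarrow> G i \<in> sets unit_lebesgue \<and> 0 < measure unit_lebesgue (G i)"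
    and S: "\<And>i j. 1 \<le> i \<Longrightarrow> i < j \<Longrightarrow> j \<le> n \<Longrightarrow> sep w (G i) (G j)"
    using nontrivial_weight_separated_sets[OF nontrivial, of n] by blast
  obtain d0 where d0: "d0 > 0" "\<And>E. E \<in> sets unit_lebesgue \<Longrightarrow> measure unit_lebesgue E \<le> d0 \<Longrightarrow> indicat_real E \<in> X"
    using exists_small_indicators by blast
  have "\<exists>E \<in> sets unit_lebesgue. E \<subseteq> G i \<and> measure unit_lebesgue E = min d0 (measure unit_lebesgue (G i))"
    if "i \<in> {1..n}" for i
    using G[OF that] d0 by (intro exists_subset_of_measure) auto
  then obtain E where E: "\<And>i. i \<in> {1..n} \<Longrightarrow> E i \<in> sets unit_lebesgue \<and> E i \<subseteq> G i \<and>
      measure unit_lebesgue (E i) = min d0 (measure unit_lebesgue (G i))"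
    by metis
  have EX: "indicat_real (E i) \<in> X" if "i \<in> {1..n}" for i
    using E[OF that] d0 by auto
  have Epos: "0 < nrm (indicat_real (E i))" if "i \<in> {1..n}" for i
    using E[OF that] G[OF that] EX[OF that] d0 by (intro nrm_indicator_pos) auto
  define x where "x i t = inverse (nrm (indicat_real (E i))) * indicat_real (E i) t" for i t
  have fs: "fsupp (x i) \<subseteq> G i" if "i \<in> {1..n}" for i
    using E[OF that] by (auto simp: fsupp_def x_def indicator_def split: if_splits)
  have "admissible w n x"
    unfolding admissible_def
  proof (intro conjI allI impI ballI)
    show "x i \<in> X" if "i \<in> {1..n}" for i
      unfolding x_def using EX[OF that] by (rule scale)
    show "sep w (fsupp (x i)) (fsupp (x j))" if "1 \<le> i \<and> i < j \<and> j \<le> n" for i j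
      using that by (intro sep_mono[OF S fs fs]) auto
  qed
  moreover have "nrm (x i) = 1" if "i \<in> {1..n}" for i
    unfolding x_def using Epos[OF that] by (subst nrm_scale[OF EX[OF that]]) simp
  ultimately show ?thesis by blast
qed

section \<open>Norms of sums of separated unit vectors\<close>

definition unit_family :: "nat \<Rightarrow> nat \<Rightarrow> real \<Rightarrow> real" where
  "unit_family n = (SOME x. admissible w n x \<and> (\<forall>i\<in>{1..n}. nrm (x i) = 1))"

text \<open>By \<open>compare_families\<close> a different choice of unit vectors changes this value
  by a factor of at most \<open>K\<close>.\<close>

definition lam :: "nat \<Rightarrow> real" where
  "lam n = nrm (\<lambda>t. \<Sum>i=1..n. unit_family n i t)"

lemma admissible_unit_family: "admissible w n (unit_family n)"
  and nrm_unit_family: "i \<in> {1..n} \<Longrightarrow> nrm (unit_family n i) = 1"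
  using someI_ex[OF exists_unit_family[of n]] by (auto simp: unit_family_def)

lemma unit_family_mem: "i \<in> {1..n} \<Longrightarrow> unit_family n i \<in> X"
  using admissible_unit_family by (auto simp: admissible_def)

lemma lam_0: "lam 0 = 0"
  by (simp add: lam_def nrm_zero)

lemma nrm_sum_compare_lam:
  assumes "admissible w n x" "\<And>i. i \<in> {1..n} \<Longrightarrow> nrm (x i) = 1"
  shows "nrm (\<lambda>t. \<Sum>i=1..n. x i t) \<le> K * lam n" "lam n \<le> K * nrm (\<lambda>t. \<Sum>i=1..n. x i t)"
  unfolding lam_def
  by (intro compare_families assms admissible_unit_family, simp add: assms(2) nrm_unit_family)+

lemma lam_ge_1: "1 \<le> n \<Longrightarrow> 1 \<le> lam n"
  using admissible_component_le[OF weight admissible_unit_family, of 1 n] nrm_unit_family[of 1 n]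
  by (simp add: lam_def)

lemma lam_le: "lam n \<le> real n"
  using nrm_sum_le[of "{1..n}" "unit_family n"] unit_family_mem nrm_unit_family
  by (simp add: lam_def)

text \<open>The first \<open>m\<close> members of \<open>unit_family n\<close> have a sum of norm at
  most \<open>lam n\<close>. The factor \<open>K\<close> arises because \<open>unit_family m\<close>
  may be another family.\<close>

lemma lam_almost_mono:
  assumes "m \<le> n"
  shows "lam m \<le> K * lam n"
proof -
  have "admissible w m (unit_family n)"
    using admissible_unit_family[of n] assms by (auto simp: admissible_def)
  then have "lam m \<le> K * nrm (\<lambda>t. \<Sum>i=1..m. unit_family n i t)"
    using nrm_unit_family assms by (intro nrm_sum_compare_lam) auto
  also have "(\<lambda>t. \<Sum>i=1..m. unit_family n i t) = (\<lambda>t. \<Sum>i=1..n. (if i \<le> m then 1 else 0) * unit_family n i t)"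
  proof
    fix t
    have "(\<Sum>i=1..m. unit_family n i t) = (\<Sum>i=1..m. (if i \<le> m then 1 else 0) * unit_family n i t)"
      by (intro sum.cong) auto
    also have "\<dots> = (\<Sum>i=1..n. (if i \<le> m then 1 else 0) * unit_family n i t)"
      using assms by (intro sum.mono_neutral_left) auto
    finally show "(\<Sum>i=1..m. unit_family n i t) = (\<Sum>i=1..n. (if i \<le> m then 1 else 0) * unit_family n i t)" .
  qed
  also have "nrm \<dots> \<le> 1 * lam n"
    unfolding lam_def by (intro admissible_scale_le[OF weight admissible_unit_family]) auto
  finally show ?thesis using K_ge_1 by simp
qed

text \<open>Block \<open>i\<close> has the indices from \<open>s (i - 1) + 1\<close> to
  \<open>s i\<close>, and is empty if \<open>m i = 0\<close>. All indices of an earlier block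
  precede those of a later one, so \<open>sep_UN\<close> separates the block sums.\<close>

lemma block_sums:
  fixes m :: "nat \<Rightarrow> nat"
  defines "s \<equiv> \<lambda>i. \<Sum>j=1..i. m j"
  assumes x: "admissible w (s n) x"
  shows "admissible w n (\<lambda>i t. \<Sum>j=1..m i. x (s (i - 1) + j) t)" (is ?A)
    and "(\<Sum>i=1..n. \<Sum>j=1..m i. x (s (i - 1) + j) t) = (\<Sum>k=1..s n. x k t)" (is ?B)
    and "i \<in> {1..n} \<Longrightarrow> admissible w (m i) (\<lambda>j. x (s (i - 1) + j))"
    and "i \<in> {1..n} \<Longrightarrow> j \<in> {1..m i} \<Longrightarrow> s (i - 1) + j \<in> {1..s n}"
proof -
  have mono: "s i \<le> s j" if "i \<le> j" for i j
    unfolding s_def using that by (intro sum_mono2) auto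
  have rec: "s i = s (i - 1) + m i" if "1 \<le> i" for i
    using that unfolding s_def by (cases i) auto
  show in_range: "s (i - 1) + j \<in> {1..s n}" if "i \<in> {1..n}" "j \<in> {1..m i}" for i j
    using that rec[of i] mono[of i n] by auto
  have xX: "x k \<in> X" if "k \<in> {1..s n}" for k using x that by (auto simp: admissible_def)
  have xsep: "sep w (fsupp (x k)) (fsupp (x l))" if "k \<in> {1..s n}" "l \<in> {1..s n}" "k < l" for k l
    using x that by (auto simp: admissible_def)
  show "admissible w (m i) (\<lambda>j. x (s (i - 1) + j))" if "i \<in> {1..n}" for i
    unfolding admissible_def using in_range[OF that] by (auto intro!: xX xsep)
  show ?B
  proof (induction n)
    case 0
    then show ?case by (simp add: s_def)
  next
    case (Suc n)
    have "(\<Sum>k=1..s (Suc n). x k t) = (\<Sum>k=1..s n. x k t) + (\<Sum>k=1 + s n..m (Suc n) + s n. x k t)"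
      using sum.ub_add_nat[of 1 "s n" "\<lambda>k. x k t" "m (Suc n)"] rec[of "Suc n"] by (simp add: add.commute)
    then show ?case
      using Suc by (simp only: sum.shift_bounds_cl_nat_ivl) (simp add: add.commute)
  qed
  show ?A
    unfolding admissible_def
  proof (intro conjI allI impI ballI)
    show "(\<lambda>t. \<Sum>j=1..m i. x (s (i - 1) + j) t) \<in> X" if "i \<in> {1..n}" for i
      using in_range[OF that] by (intro sum_mem xX) auto
    fix i i' assume i: "1 \<le> i \<and> i < i' \<and> i' \<le> n"
    have sub: "fsupp (\<lambda>t. \<Sum>j=1..m i. x (s (i - 1) + j) t) \<subseteq> (\<Union>j\<in>{1..m i}. fsupp (x (s (i - 1) + j)))" for i
    proof
      fix t assume "t \<in> fsupp (\<lambda>t. \<Sum>j=1..m i. x (s (i - 1) + j) t)"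
      then have t: "t \<in> {0..1}" "(\<Sum>j=1..m i. x (s (i - 1) + j) t) \<noteq> 0" by (auto simp: fsupp_def)
      from t(2) obtain j where "j \<in> {1..m i}" "x (s (i - 1) + j) t \<noteq> 0"
        by (rule sum.not_neutral_contains_not_neutral)
      then show "t \<in> (\<Union>j\<in>{1..m i}. fsupp (x (s (i - 1) + j)))" using t by (auto simp: fsupp_def)
    qed
    have "sep w (\<Union>j\<in>{1..m i}. fsupp (x (s (i - 1) + j))) (\<Union>j\<in>{1..m i'}. fsupp (x (s (i' - 1) + j)))"
    proof (intro sep_UN xsep in_range)
      fix j j' assume j: "j \<in> {1..m i}" "j' \<in> {1..m i'}"
      have "s (i - 1) + j \<le> s i" using rec[of i] i j by auto
      also have "\<dots> \<le> s (i' - 1)" using i by (intro mono) auto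
      finally show "s (i - 1) + j < s (i' - 1) + j'" using j by auto
    qed (use i in auto)
    then show "sep w (fsupp (\<lambda>t. \<Sum>j=1..m i. x (s (i - 1) + j) t)) (fsupp (\<lambda>t. \<Sum>j=1..m i'. x (s (i' - 1) + j) t))"
      by (rule sep_mono[OF _ sub sub])
  qed
qed

text \<open>Each \<open>z i\<close> is replaced by a block of \<open>m i\<close> unit vectors, all
  taken from one long family. The block norms equal \<open>lam (m i)\<close> only up to
  \<open>K\<close>; correcting them by factors \<open>r i\<close> costs one \<open>K\<close>, and
  \<open>compare_families\<close> costs the other.\<close>

lemma nrm_sum_compare_lam_sum:
  assumes z: "admissible w n z" "\<And>i. i \<in> {1..n} \<Longrightarrow> nrm (z i) = lam (m i)"
  shows "nrm (\<lambda>t. \<Sum>i=1..n. z i t) \<le> K\<^sup>2 * lam (\<Sum>i=1..n. m i)"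
    and "lam (\<Sum>i=1..n. m i) \<le> K\<^sup>2 * nrm (\<lambda>t. \<Sum>i=1..n. z i t)"
proof -
  define s where "s i = (\<Sum>j=1..i. m j)" for i
  define x where "x = unit_family (s n)"
  define y where "y i t = (\<Sum>j=1..m i. x (s (i - 1) + j) t)" for i t
  have x: "admissible w (s n) x" by (simp add: x_def admissible_unit_family)
  note blocks = block_sums[of m n x, folded s_def, OF x]
  have y: "admissible w n y" using blocks(1) by (simp add: y_def[abs_def])
  have sum_y: "nrm (\<lambda>t. \<Sum>i=1..n. y i t) = lam (s n)"
    using blocks(2) by (simp add: lam_def x_def y_def)
  have nrm_y: "nrm (y i) \<le> K * lam (m i)" "lam (m i) \<le> K * nrm (y i)" if i: "i \<in> {1..n}" for i
  proof -
    have 1: "nrm (x (s (i - 1) + j)) = 1" if "j \<in> {1..m i}" for j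
      using blocks(4)[OF i that] by (simp add: x_def nrm_unit_family)
    show "nrm (y i) \<le> K * lam (m i)" "lam (m i) \<le> K * nrm (y i)"
      unfolding y_def[abs_def] using nrm_sum_compare_lam[OF blocks(3)[OF i] 1] by auto
  qed
  \<comment> \<open>An empty block has norm 0, which is already the required \<open>lam 0\<close>.
    The value 1 lies between \<open>inverse K\<close> and \<open>K\<close>.\<close>
  define r where "r i = (if m i = 0 then 1 else lam (m i) / nrm (y i))" for i
  have ypos: "0 < nrm (y i)" "0 < lam (m i)" if "i \<in> {1..n}" "m i \<noteq> 0" for i
  proof -
    show "0 < lam (m i)" using lam_ge_1[of "m i"] that by simp
    also have "lam (m i) \<le> K * nrm (y i)" using nrm_y that by simp
    finally show "0 < nrm (y i)" using K_ge_1 by (simp add: zero_less_mult_iff)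
  qed
  have r: "inverse K \<le> r i" "r i \<le> K" if "i \<in> {1..n}" for i
    using nrm_y[OF that] ypos[OF that] K_ge_1 by (auto simp: r_def field_simps)
  have ry: "nrm (\<lambda>t. r i * y i t) = nrm (z i)" if i: "i \<in> {1..n}" for i
  proof -
    have "y i \<in> X" using y i by (auto simp: admissible_def)
    then have "nrm (\<lambda>t. r i * y i t) = \<bar>r i\<bar> * nrm (y i)" by (rule nrm_scale)
    also have "\<dots> = lam (m i)"
    proof (cases "m i = 0")
      case True
      then show ?thesis by (simp add: lam_0 y_def[abs_def] nrm_zero)
    next
      case False
      then show ?thesis using ypos[OF i] by (simp add: r_def)
    qed
    finally show ?thesis using z(2)[OF i] by simp
  qed
  note ray = admissible_scale[OF y, of r]
  have "nrm (\<lambda>t. \<Sum>i=1..n. z i t) \<le> K * nrm (\<lambda>t. \<Sum>i=1..n. r i * y i t)"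
    using ry by (intro compare_families z(1) ray) auto
  also have "\<dots> \<le> K * (K * lam (s n))"
  proof (rule mult_left_mono)
    have "\<bar>r i\<bar> \<le> K" if "i \<in> {1..n}" for i
      using r[OF that] K_ge_1 by (smt (verit) inverse_nonnegative_iff_nonnegative)
    then show "nrm (\<lambda>t. \<Sum>i=1..n. r i * y i t) \<le> K * lam (s n)"
      unfolding sum_y[symmetric] using K_ge_1 by (intro admissible_scale_le[OF weight y]) auto
  qed (use K_ge_1 in simp)
  finally show "nrm (\<lambda>t. \<Sum>i=1..n. z i t) \<le> K\<^sup>2 * lam (\<Sum>i=1..n. m i)"
    by (simp add: power2_eq_square s_def)
  have "inverse K * lam (s n) \<le> nrm (\<lambda>t. \<Sum>i=1..n. r i * y i t)"
    unfolding sum_y[symmetric] using r K_ge_1 by (intro admissible_scale_ge[OF weight y]) auto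
  also have "\<dots> \<le> K * nrm (\<lambda>t. \<Sum>i=1..n. z i t)"
    using ry by (intro compare_families z(1) ray) auto
  finally show "lam (\<Sum>i=1..n. m i) \<le> K\<^sup>2 * nrm (\<lambda>t. \<Sum>i=1..n. z i t)"
    using K_ge_1 by (simp add: power2_eq_square s_def field_simps)
qed

text \<open>Equal block lengths \<open>m\<close>: the multiples
  \<open>lam m * unit_family n i\<close> have norm \<open>lam m\<close>, and their sum has norm
  exactly \<open>lam m * lam n\<close>.\<close>

lemma lam_mult:
  assumes "1 \<le> m" "1 \<le> n"
  shows "lam (m * n) \<le> K\<^sup>2 * (lam m * lam n)" "lam m * lam n \<le> K\<^sup>2 * lam (m * n)"
proof -
  let ?z = "\<lambda>i t. lam m * unit_family n i t"
  have lm: "0 \<le> lam m" using lam_ge_1[OF assms(1)] by simp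
  have z: "admissible w n ?z" using admissible_scale[OF admissible_unit_family] .
  have nz: "nrm (?z i) = lam m" if "i \<in> {1..n}" for i
    using nrm_scale[OF unit_family_mem[OF that]] nrm_unit_family[OF that] lm by simp
  have "nrm (\<lambda>t. \<Sum>i=1..n. ?z i t) = nrm (\<lambda>t. lam m * (\<Sum>i=1..n. unit_family n i t))"
    by (simp add: sum_distrib_left)
  also have "\<dots> = lam m * lam n"
    using lm by (subst nrm_scale[OF sum_mem[OF _ unit_family_mem]]) (simp_all add: lam_def)
  finally have "nrm (\<lambda>t. \<Sum>i=1..n. ?z i t) = lam m * lam n" .
  then show "lam (m * n) \<le> K\<^sup>2 * (lam m * lam n)" "lam m * lam n \<le> K\<^sup>2 * lam (m * n)"
    using nrm_sum_compare_lam_sum[OF z nz] by (simp_all add: mult.commute[of n])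
qed

section \<open>Power growth of \<open>lam\<close> and the resulting lp estimates\<close>

lemma lam_power:
  "\<exists>c D. 0 \<le> c \<and> c \<le> 1 \<and> 1 \<le> D \<and>
    (\<forall>n\<ge>1. real n powr c \<le> D * lam n \<and> lam n \<le> D * real n powr c)"
proof (rule almost_multiplicative_power)
  have K2: "1 \<le> K\<^sup>2" "K \<le> K\<^sup>2" using K_ge_1 by (auto simp: self_le_power)
  show "1 \<le> K\<^sup>2" by fact
  show "1 \<le> K\<^sup>2 * lam n" if "1 \<le> n" for n
    using mult_mono[OF K2(1) lam_ge_1[OF that]] K2 by simp
  show "lam n \<le> K\<^sup>2 * real n" if "1 \<le> n" for n
    using lam_le[of n] mult_right_mono[OF K2(1), of "real n"] by simp
  show "lam m \<le> K\<^sup>2 * lam n" if "1 \<le> m" "m \<le> n" for m n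
    using lam_almost_mono[OF that(2)] mult_right_mono[OF K2(2), of "lam n"] lam_ge_1[of n] that by linarith
qed (use lam_mult in auto)

text \<open>The case of bounded \<open>lam\<close>. The family compares with the multiples
  \<open>nrm (x i)\<close> of unit vectors, whose sum has norm at most the largest coefficient times
  \<open>lam n\<close>. The other bound is \<open>admissible_component_le\<close>.\<close>

lemma max_estimate:
  assumes D: "\<And>n. 1 \<le> n \<Longrightarrow> lam n \<le> D" and n: "1 \<le> n" and x: "admissible w n x"
  shows "nrm (\<lambda>t. \<Sum>i=1..n. x i t) \<le> K\<^sup>2 * D * lp_norm \<infinity> n (\<lambda>i. nrm (x i))"
    and "lp_norm \<infinity> n (\<lambda>i. nrm (x i)) \<le> nrm (\<lambda>t. \<Sum>i=1..n. x i t)"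
proof -
  have xX: "x i \<in> X" if "i \<in> {1..n}" for i using x that by (auto simp: admissible_def)
  have nn: "0 \<le> nrm (x i)" if "i \<in> {1..n}" for i using nrm_nonneg xX that by blast
  define a where "a = lp_norm \<infinity> n (\<lambda>i. nrm (x i))"
  have a: "a = Max ((\<lambda>i. \<bar>nrm (x i)\<bar>) ` {1..n})" by (simp add: a_def lp_norm_def)
  have ge: "nrm (x i) \<le> a" if "i \<in> {1..n}" for i
  proof -
    have "\<bar>nrm (x i)\<bar> \<le> a" unfolding a using that by (intro Max_ge) auto
    then show ?thesis by simp
  qed
  have a0: "0 \<le> a" using ge[of 1] nn[of 1] n by simp
  show "lp_norm \<infinity> n (\<lambda>i. nrm (x i)) \<le> nrm (\<lambda>t. \<Sum>i=1..n. x i t)"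
    unfolding a_def[symmetric] a using n nn admissible_component_le[OF weight x] by auto
  let ?y = "\<lambda>i t. nrm (x i) * unit_family n i t"
  have "nrm (\<lambda>t. \<Sum>i=1..n. x i t) \<le> K * nrm (\<lambda>t. \<Sum>i=1..n. ?y i t)"
  proof (intro compare_families x admissible_scale admissible_unit_family)
    show "nrm (x i) = nrm (?y i)" if "i \<in> {1..n}" for i
      using nrm_scale[OF unit_family_mem[OF that]] nrm_unit_family[OF that] nn[OF that] by simp
  qed
  also have "\<dots> \<le> K * (a * lam n)"
    using K_ge_1 unfolding lam_def
    by (intro mult_left_mono admissible_scale_le[OF weight admissible_unit_family]) (use ge nn a0 in auto)
  also have "\<dots> \<le> K\<^sup>2 * (a * D)"
    using K_ge_1 a0 D[OF n] lam_ge_1[OF n] by (intro mult_mono mult_left_mono) (auto simp: power2_eq_square)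
  finally show "nrm (\<lambda>t. \<Sum>i=1..n. x i t) \<le> K\<^sup>2 * D * lp_norm \<infinity> n (\<lambda>i. nrm (x i))"
    by (simp add: a_def mult_ac)
qed

text \<open>With \<open>m i\<close> close to \<open>M * b i\<close>, \<open>lam (m i)\<close> is
  comparable to \<open>T * a i\<close> for \<open>T = M powr c\<close>. So, up to constants,
  \<open>T\<close> times the family acts like blocks of \<open>m i\<close> unit vectors, whose total
  has norm about \<open>(M * S) powr c = T * S powr c\<close>. The factor \<open>T\<close>
  cancels.\<close>

lemma power_estimate:
  assumes c: "0 < c" "c \<le> 1" and D1: "1 \<le> D"
    and D: "\<And>n. 1 \<le> n \<Longrightarrow> real n powr c \<le> D * lam n \<and> lam n \<le> D * real n powr c"
    and x: "admissible w n x"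
  shows "nrm (\<lambda>t. \<Sum>i=1..n. x i t) \<le> 2 * K\<^sup>2 * D\<^sup>2 * lp_norm (ereal (1 / c)) n (\<lambda>i. nrm (x i))"
    and "lp_norm (ereal (1 / c)) n (\<lambda>i. nrm (x i)) \<le> 2 * K\<^sup>2 * D\<^sup>2 * nrm (\<lambda>t. \<Sum>i=1..n. x i t)"
proof -
  have xX: "x i \<in> X" if "i \<in> {1..n}" for i using x that by (auto simp: admissible_def)
  define a where "a i = nrm (x i)" for i
  have a0: "0 \<le> a i" if "i \<in> {1..n}" for i unfolding a_def using nrm_nonneg xX that by blast
  define b where "b i = a i powr (1 / c)" for i
  have b0: "0 \<le> b i" for i by (simp add: b_def)
  have bc: "b i powr c = a i" if "i \<in> {1..n}" for i
    using a0[OF that] c by (simp add: b_def powr_powr)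
  define S where "S = (\<Sum>i=1..n. b i)"
  have lp: "lp_norm (ereal (1 / c)) n (\<lambda>i. nrm (x i)) = S powr c"
  proof -
    have "(\<Sum>i=1..n. \<bar>nrm (x i)\<bar> powr (1 / c)) = S"
      unfolding S_def b_def a_def[symmetric] using a0 by (intro sum.cong) auto
    then show ?thesis by (simp add: lp_norm_def)
  qed
  \<comment> \<open>\<open>M\<close> is at least \<open>inverse (b i)\<close> for every nonzero
    \<open>b i\<close>, so rounding \<open>M * b i\<close> up to an integer at most doubles it. The
    summand 1 keeps \<open>M\<close> positive when all \<open>b i\<close> vanish.\<close>
  define M where "M = 1 + (\<Sum>i=1..n. inverse (b i))"
  have M1: "1 \<le> M" unfolding M_def using b0 by (simp add: sum_nonneg)
  have Mb: "1 \<le> M * b i" if "i \<in> {1..n}" "b i \<noteq> 0" for i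
  proof -
    have "inverse (b i) \<le> (\<Sum>i=1..n. inverse (b i))"
      using that b0 by (intro member_le_sum) auto
    then have "inverse (b i) \<le> M" by (simp add: M_def)
    then show ?thesis using that b0[of i] by (simp add: field_simps)
  qed
  define m where "m i = nat \<lceil>M * b i\<rceil>" for i
  have m: "M * b i \<le> real (m i)" "real (m i) \<le> 2 * (M * b i)" if "i \<in> {1..n}" for i
  proof -
    show "M * b i \<le> real (m i)" unfolding m_def by (rule real_nat_ceiling_ge)
    show "real (m i) \<le> 2 * (M * b i)"
    proof (cases "b i = 0")
      case False
      have "real (m i) \<le> M * b i + 1"
        unfolding m_def using M1 b0[of i] by simp
      then show ?thesis using Mb[OF that False] by simp
    qed (simp add: m_def)
  qed
  define T where "T = M powr c"
  have T: "0 < T" using M1 by (simp add: T_def)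
  have two: "(2::real) powr c \<le> 2" using powr_mono[of c 1 2] c by simp
  \<comment> \<open>Used twice: for each \<open>b i\<close> with its \<open>m i\<close>, and for
    \<open>S\<close> with the total number of unit vectors. As \<open>c \<le> 1\<close>, the
    rounding factor 2 stays at most 2.\<close>
  have between: "T * e powr c \<le> real k powr c" "real k powr c \<le> 2 * T * e powr c"
    if "M * e \<le> real k" "real k \<le> 2 * (M * e)" "0 \<le> e" for e k
  proof -
    have "(M * e) powr c \<le> real k powr c" using that M1 c by (intro powr_mono2) auto
    then show "T * e powr c \<le> real k powr c" using that M1 by (simp add: T_def powr_mult)
    have "real k powr c \<le> (2 * (M * e)) powr c" using that c by (intro powr_mono2) auto
    also have "\<dots> = 2 powr c * (T * e powr c)" using that M1 by (simp add: T_def powr_mult)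
    also have "\<dots> \<le> 2 * (T * e powr c)" using two T by (intro mult_right_mono) auto
    finally show "real k powr c \<le> 2 * T * e powr c" by simp
  qed
  \<comment> \<open>The power law extends to \<open>k = 0\<close>, since both sides are then 0;
    vanishing members lead to \<open>m i = 0\<close>.\<close>
  have lam: "real k powr c \<le> D * lam k" "lam k \<le> D * real k powr c" for k
    using D[of k] by (cases "k = 0"; simp add: lam_0)+
  have lam_m: "T * a i \<le> D * lam (m i)" "lam (m i) \<le> 2 * D * T * a i" if i: "i \<in> {1..n}" for i
  proof -
    note B = between[OF m[OF i] b0, unfolded bc[OF i]]
    show "T * a i \<le> D * lam (m i)" using B(1) lam(1) order_trans by blast
    have "lam (m i) \<le> D * real (m i) powr c" by (rule lam)
    also have "\<dots> \<le> D * (2 * T * a i)" using B(2) D1 by (intro mult_left_mono) auto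
    finally show "lam (m i) \<le> 2 * D * T * a i" by simp
  qed
  \<comment> \<open>Brings \<open>x i\<close> to norm exactly \<open>lam (m i)\<close>. If
    \<open>a i = 0\<close>, both norms are 0, and the value \<open>T\<close> lies in the range
    required of the factors.\<close>
  define r where "r i = (if a i = 0 then T else lam (m i) / a i)" for i
  have r: "T / D \<le> r i" "r i \<le> 2 * D * T" if "i \<in> {1..n}" for i
  proof -
    have "T / D \<le> T" using T D1 by (simp add: field_simps)
    moreover have "1 * T \<le> 2 * D * T" using T D1 by (intro mult_right_mono) auto
    ultimately show "T / D \<le> r i" "r i \<le> 2 * D * T"
      using lam_m[OF that] a0[OF that] D1 by (auto simp: r_def field_simps)
  qed
  let ?z = "\<lambda>i t. r i * x i t"
  have r0: "0 \<le> r i" if "i \<in> {1..n}" for i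
    using r(1)[OF that] T D1 by (meson divide_nonneg_pos less_le_trans less_imp_le order_trans zero_less_one)
  have z: "nrm (?z i) = lam (m i)" if "i \<in> {1..n}" for i
  proof -
    have "nrm (?z i) = r i * a i"
      using nrm_scale[OF xX[OF that], of "r i"] r0[OF that] by (simp add: a_def)
    also have "\<dots> = lam (m i)"
      using lam_m[OF that] T D1 by (auto simp: r_def b_def m_def lam_0)
    finally show ?thesis .
  qed
  define N where "N = (\<Sum>i=1..n. m i)"
  note Z = nrm_sum_compare_lam_sum[OF admissible_scale[OF x] z, folded N_def]
  have N: "M * S \<le> real N" "real N \<le> 2 * (M * S)"
    unfolding S_def N_def of_nat_sum sum_distrib_left using m by (auto intro!: sum_mono)
  have S0: "0 \<le> S" unfolding S_def by (intro sum_nonneg) (simp add: b0)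
  note NS = between[OF N S0]
  let ?x = "nrm (\<lambda>t. \<Sum>i=1..n. x i t)" and ?zz = "nrm (\<lambda>t. \<Sum>i=1..n. r i * x i t)"
  have K0: "0 \<le> K\<^sup>2" by simp
  \<comment> \<open>Both chains pass through \<open>lam N\<close>: one \<open>D\<close> comes from
    the range of \<open>r\<close>, one from the power law at \<open>N\<close>, and the 2 from
    rounding.\<close>
  have "T / D * ?x \<le> ?zz"
    using r T D1 by (intro admissible_scale_ge[OF weight x]) auto
  also have "\<dots> \<le> K\<^sup>2 * lam N" by (rule Z)
  also have "\<dots> \<le> K\<^sup>2 * (D * real N powr c)" using lam K0 by (intro mult_left_mono)
  also have "\<dots> \<le> K\<^sup>2 * (D * (2 * T * S powr c))" using NS(2) D1 K0 by (intro mult_left_mono) auto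
  finally have "T * ?x \<le> T * (2 * K\<^sup>2 * D\<^sup>2 * S powr c)"
    using D1 by (simp add: field_simps power2_eq_square)
  then show "?x \<le> 2 * K\<^sup>2 * D\<^sup>2 * lp_norm (ereal (1 / c)) n (\<lambda>i. nrm (x i))"
    using T by (simp add: lp)
  have "T * S powr c \<le> real N powr c" by (rule NS)
  also have "\<dots> \<le> D * lam N" by (rule lam)
  also have "\<dots> \<le> D * (K\<^sup>2 * ?zz)" using Z(2) D1 by (intro mult_left_mono) auto
  also have "\<dots> \<le> D * (K\<^sup>2 * (2 * D * T * ?x))"
    using r r0 T D1 K0 by (intro mult_left_mono admissible_scale_le[OF weight x]) auto
  finally have "T * S powr c \<le> T * (2 * K\<^sup>2 * D\<^sup>2 * ?x)"
    by (simp add: power2_eq_square mult_ac)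
  then show "lp_norm (ereal (1 / c)) n (\<lambda>i. nrm (x i)) \<le> 2 * K\<^sup>2 * D\<^sup>2 * ?x"
    using T by (simp add: lp)
qed

text \<open>Exponent \<open>c = 0\<close> means bounded \<open>lam\<close> and gives
  \<open>p = \<infinity>\<close>; otherwise \<open>p = 1 / c\<close>, which is at least 1 because
  \<open>c \<le> 1\<close>.\<close>

lemma lp_estimate:
  "\<exists>B>0. \<exists>p::ereal. 1 \<le> p \<and> (\<forall>n\<ge>1. \<forall>x. admissible w n x \<longrightarrow>
     nrm (\<lambda>t. \<Sum>i=1..n. x i t) \<le> B * lp_norm p n (\<lambda>i. nrm (x i)) \<and>
     lp_norm p n (\<lambda>i. nrm (x i)) \<le> B * nrm (\<lambda>t. \<Sum>i=1..n. x i t))"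
proof -
  obtain c D where c: "0 \<le> c" "c \<le> 1" and D1: "1 \<le> D"
    and D: "\<And>n. 1 \<le> n \<Longrightarrow> real n powr c \<le> D * lam n \<and> lam n \<le> D * real n powr c"
    using lam_power by blast
  show ?thesis
  proof (cases "c = 0")
    case True
    then have D': "lam n \<le> D" if "1 \<le> n" for n using D[OF that] that by simp
    have B: "1 \<le> K\<^sup>2 * D" using K_ge_1 D1 by (simp add: mult_ge1_I)
    have "nrm (\<lambda>t. \<Sum>i=1..n. x i t) \<le> K\<^sup>2 * D * lp_norm \<infinity> n (\<lambda>i. nrm (x i)) \<and>
        lp_norm \<infinity> n (\<lambda>i. nrm (x i)) \<le> K\<^sup>2 * D * nrm (\<lambda>t. \<Sum>i=1..n. x i t)"
      if "1 \<le> n" "admissible w n x" for n x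
    proof
      have "0 \<le> nrm (\<lambda>t. \<Sum>i=1..n. x i t)"
        using that by (intro nrm_nonneg sum_mem) (auto simp: admissible_def)
      then have "1 * nrm (\<lambda>t. \<Sum>i=1..n. x i t) \<le> K\<^sup>2 * D * nrm (\<lambda>t. \<Sum>i=1..n. x i t)"
        using B by (intro mult_right_mono)
      then show "lp_norm \<infinity> n (\<lambda>i. nrm (x i)) \<le> K\<^sup>2 * D * nrm (\<lambda>t. \<Sum>i=1..n. x i t)"
        using max_estimate(2)[OF D' that] by simp
    qed (rule max_estimate(1)[OF D' that])
    moreover have "1 \<le> (\<infinity>::ereal)" "0 < K\<^sup>2 * D" using B by simp_all
    ultimately show ?thesis by blast
  next
    case False
    then have c0: "0 < c" using c by simp
    have "1 \<le> ereal (1 / c)" using c0 c by (simp add: one_ereal_def)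
    moreover have "0 < 2 * K\<^sup>2 * D\<^sup>2" using K_ge_1 D1 by simp
    ultimately show ?thesis using power_estimate[OF c0 c(2) D1 D] by blast
  qed
qed

end

section \<open>Equivalence of decomposability with a two-sided lp estimate\<close>

theorem proposition3p2:
  fixes w :: "real \<Rightarrow> real"
    and X :: "(real \<Rightarrow> real) set"
    and nrm :: "(real \<Rightarrow> real) \<Rightarrow> real"
  assumes "nontrivial_weight w"
    and "symmetric_space X nrm"
  shows "w_decomposable w X nrm \<longleftrightarrow>
    (\<exists>C>0. \<exists>p::ereal. 1 \<le> p \<and>
      (\<forall>n\<ge>1. \<forall>x. (\<forall>i\<in>{1..n}. x i \<in> X) \<and> w_separated w n (\<lambda>i. fsupp (x i)) \<longrightarrow>
        inverse C * nrm (\<lambda>t. \<Sum>i=1..n. x i t) \<le> lp_norm p n (\<lambda>i. nrm (x i)) \<and>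
        lp_norm p n (\<lambda>i. nrm (x i)) \<le> C * nrm (\<lambda>t. \<Sum>i=1..n. x i t)))"
proof -
  interpret symmetric_space X nrm by fact
  have w: "weight w" using assms(1) by (simp add: nontrivial_weight_def)
  show ?thesis
  proof
    assume "w_decomposable w X nrm"
    then obtain C where "decomposable_space X nrm w C"
      using assms unfolding w_decomposable_def decomposable_space_def decomposable_space_axioms_def
      by blast
    then interpret decomposable_space X nrm w C .
    obtain B p where B: "0 < B" "1 \<le> p"
      and est: "\<And>n x. 1 \<le> n \<Longrightarrow> admissible w n x \<Longrightarrow>
        nrm (\<lambda>t. \<Sum>i=1..n. x i t) \<le> B * lp_norm p n (\<lambda>i. nrm (x i)) \<and>
        lp_norm p n (\<lambda>i. nrm (x i)) \<le> B * nrm (\<lambda>t. \<Sum>i=1..n. x i t)"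
      using lp_estimate by blast
    have "inverse B * nrm (\<lambda>t. \<Sum>i=1..n. x i t) \<le> lp_norm p n (\<lambda>i. nrm (x i)) \<and>
        lp_norm p n (\<lambda>i. nrm (x i)) \<le> B * nrm (\<lambda>t. \<Sum>i=1..n. x i t)"
      if "1 \<le> n" "(\<forall>i\<in>{1..n}. x i \<in> X) \<and> w_separated w n (\<lambda>i. fsupp (x i))" for n x
      using est[of n x] that B(1) admissible_iff_w_separated[OF w, of n x] by (simp add: field_simps)
    then show "\<exists>C>0. \<exists>p::ereal. 1 \<le> p \<and>
      (\<forall>n\<ge>1. \<forall>x. (\<forall>i\<in>{1..n}. x i \<in> X) \<and> w_separated w n (\<lambda>i. fsupp (x i)) \<longrightarrow>
        inverse C * nrm (\<lambda>t. \<Sum>i=1..n. x i t) \<le> lp_norm p n (\<lambda>i. nrm (x i)) \<and>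
        lp_norm p n (\<lambda>i. nrm (x i)) \<le> C * nrm (\<lambda>t. \<Sum>i=1..n. x i t))"
      using B by blast
  next
    assume "\<exists>C>0. \<exists>p::ereal. 1 \<le> p \<and>
      (\<forall>n\<ge>1. \<forall>x. (\<forall>i\<in>{1..n}. x i \<in> X) \<and> w_separated w n (\<lambda>i. fsupp (x i)) \<longrightarrow>
        inverse C * nrm (\<lambda>t. \<Sum>i=1..n. x i t) \<le> lp_norm p n (\<lambda>i. nrm (x i)) \<and>
        lp_norm p n (\<lambda>i. nrm (x i)) \<le> C * nrm (\<lambda>t. \<Sum>i=1..n. x i t))"
    then obtain C p where C: "0 < C"
      and est: "\<And>n x. 1 \<le> n \<Longrightarrow> admissible w n x \<Longrightarrow>
        inverse C * nrm (\<lambda>t. \<Sum>i=1..n. x i t) \<le> lp_norm p n (\<lambda>i. nrm (x i)) \<and>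
        lp_norm p n (\<lambda>i. nrm (x i)) \<le> C * nrm (\<lambda>t. \<Sum>i=1..n. x i t)"
      unfolding admissible_iff_w_separated[OF w] by blast
    \<comment> \<open>The lp norm sees only the norms of the members, so both families compare with
      one and the same number, at the cost of \<open>C\<close> each.\<close>
    have le: "nrm (\<lambda>t. \<Sum>i=1..n. x i t) \<le> C * C * nrm (\<lambda>t. \<Sum>i=1..n. y i t)"
      if "1 \<le> n" "admissible w n x" "admissible w n y" "\<And>i. i \<in> {1..n} \<Longrightarrow> nrm (x i) = nrm (y i)" for n x y
    proof -
      have "lp_norm p n (\<lambda>i. nrm (x i)) = lp_norm p n (\<lambda>i. nrm (y i))"
        unfolding lp_norm_def by (simp only: that(4) cong: image_cong sum.cong)
      then have "inverse C * nrm (\<lambda>t. \<Sum>i=1..n. x i t) \<le> C * nrm (\<lambda>t. \<Sum>i=1..n. y i t)"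
        using est[OF that(1,2)] est[OF that(1,3)] by simp
      then show ?thesis using C by (simp add: field_simps)
    qed
    have "inverse (C * C) * nrm (\<lambda>t. \<Sum>i=1..n. x i t) \<le> nrm (\<lambda>t. \<Sum>i=1..n. y i t) \<and>
        nrm (\<lambda>t. \<Sum>i=1..n. y i t) \<le> C * C * nrm (\<lambda>t. \<Sum>i=1..n. x i t)"
      if n: "1 \<le> n" and xy: "\<forall>i\<in>{1..n}. x i \<in> X \<and> y i \<in> X \<and> nrm (x i) = nrm (y i)"
        and s: "w_separated w n (\<lambda>i. fsupp (x i) \<union> fsupp (y i))" for n x y
    proof -
      \<comment> \<open>Separation of the unions of supports passes to subsets, which makes
        \<open>x\<close> and \<open>y\<close> admissible individually.\<close>
      have U: "sep w (fsupp (x i) \<union> fsupp (y i)) (fsupp (x j) \<union> fsupp (y j))"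
        if "1 \<le> i" "i < j" "j \<le> n" for i j
        using s xy w that unfolding w_separated_def
        by (subst sep_iff_ess[symmetric]) (auto intro!: sets.Un fsupp_sets simp: weight_def)
      have "admissible w n x" "admissible w n y"
        unfolding admissible_def using xy by (auto intro: sep_mono[OF U])
      then show ?thesis
        using le[OF n, of x y] le[OF n, of y x] xy C by (simp add: field_simps)
    qed
    then show "w_decomposable w X nrm"
      unfolding w_decomposable_def using C by (intro exI[of _ "C * C"]) auto
  qed
qed

end
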